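(* Let $k\ge 1$ be an integer and suppose that $X\in(0,1)$ is a random variable with a bounded density. Let $D_n$ be the length of the longest path from node $n$ to the root $0$ in a $k$-SARRD with attachment $X$. Then, as $n\to\infty$, $$\frac{D_n}{\log n}\to\lambda_k\quad\text{in probability},$$ where $\lambda_k=\sup\{z\ge 1/\mathbb{E}[-\log X]:\ \Lambda^\star(1/z)\le \log k\}$.
   Context: $\log$ is the natural logarithm. A $k$-SARRD (scaled attachment random recursive DAG) with attachment $X$, also called $(X,k)$-SARRD: let $X_{x,p}$, $x\ge 0$, $1\le p\le k$, be independent copies of $X$. The nodes are $0,1,2,\dots$; node $0$ is the root (it has no parents), and every node $x\ge 1$ has $k$ parents (not necessarily distinct) $\lfloor xX_{x,1}\rfloor,\dots,\lfloor xX_{x,k}\rfloor$, with a directed edge from $x$ to each parent. $D_x$ is the number of edges on the longest directed path from $x$ to $0$ (so $D_0=0$ and $D_x=1+\max_{1\le p\le k}D_{\lfloor xX_{x,p}\rfloor}$ for $x\ge1$). Put $Y=-\log X$, $\Lambda(\lambda)=\log\mathbb{E}[e^{\lambda Y}]\in(-\infty,+\infty]$ for $\lambda\in\mathbb{R}$, and $\Lambda^\star(z)=\sup_{\lambda\in\mathbb{R}}\{\lambda z-\Lambda(\lambda)\}$. *)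

theory Defs
  imports "HOL-Probability.Probability"
begin

text \<open>
  A realisation \<open>u x p\<close> of the attachment variables determines the graph on \<open>nat\<close>.
  Repeated parents collapse to one edge, which does not affect lengths of paths.
\<close>

definition sarrd_edges :: "nat \<Rightarrow> (nat \<Rightarrow> nat \<Rightarrow> real) \<Rightarrow> (nat \<times> nat) set" where
  "sarrd_edges k u = {(x, nat \<lfloor>real x * u x p\<rfloor>) | x p. 1 \<le> x \<and> p \<in> {1..k}}"

text \<open>
  If all \<open>u x p\<close> lie in \<open>(0,1)\<close>, every edge strictly decreases the node, so the graph is acyclic,
  walks are paths, and the set below is finite and (for \<open>k \<ge> 1\<close>) nonempty.
  Outside this event, which is almost sure for a SARRD, the value is irrelevant.
\<close>

definition sarrd_depth :: "nat \<Rightarrow> (nat \<Rightarrow> nat \<Rightarrow> real) \<Rightarrow> nat \<Rightarrow> nat" where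
  "sarrd_depth k u n = Max {m. (n, 0) \<in> sarrd_edges k u ^^ m}"

text \<open>
  The family \<open>U x p\<close> is only relevant for \<open>p \<in> {1..k}\<close>. Independence includes measurability of
  every \<open>U x p\<close>.
\<close>

definition sarrd_attachment ::
  "'a measure \<Rightarrow> nat \<Rightarrow> ('a \<Rightarrow> real) \<Rightarrow> (nat \<Rightarrow> nat \<Rightarrow> 'a \<Rightarrow> real) \<Rightarrow> bool" where
  "sarrd_attachment M k X U \<longleftrightarrow>
     prob_space.indep_vars M (\<lambda>_. borel) (\<lambda>(x, p). U x p) (UNIV \<times> {1..k}) \<and>
     (\<forall>x. \<forall>p\<in>{1..k}. distr M borel (U x p) = distr M borel X)"

definition log_mgf :: "'a measure \<Rightarrow> ('a \<Rightarrow> real) \<Rightarrow> real \<Rightarrow> ereal" where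
  "log_mgf M Y l =
     (let m = \<integral>\<^sup>+ \<omega>. ennreal (exp (l * Y \<omega>)) \<partial>M
      in if m = \<infinity> then \<infinity> else ereal (ln (enn2real m)))"

definition log_mgf_dual :: "'a measure \<Rightarrow> ('a \<Rightarrow> real) \<Rightarrow> real \<Rightarrow> ereal" where
  "log_mgf_dual M Y z = (SUP l::real. ereal (l * z) - log_mgf M Y l)"

text \<open>
  For \<open>X\<close> with values in \<open>(0,1)\<close> and bounded density, the following set is nonempty (it contains
  the reciprocal of the expectation) and bounded above, so the supremum in the reals is genuine.
\<close>

definition sarrd_rate :: "'a measure \<Rightarrow> nat \<Rightarrow> ('a \<Rightarrow> real) \<Rightarrow> real" where
  "sarrd_rate M k X =
     (let Y = (\<lambda>\<omega>. - ln (X \<omega>))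
      in Sup {z. 1 / (\<integral>\<omega>. Y \<omega> \<partial>M) \<le> z \<and> log_mgf_dual M Y (1 / z) \<le> ereal (ln (real k))})"

text \<open>
  Measurability is part of the definition because \<^const>\<open>measure\<close> is \<open>0\<close> on nonmeasurable sets.
\<close>

definition tendsto_in_probability :: "'a measure \<Rightarrow> (nat \<Rightarrow> 'a \<Rightarrow> real) \<Rightarrow> real \<Rightarrow> bool" where
  "tendsto_in_probability M Z c \<longleftrightarrow>
     (\<forall>n. Z n \<in> borel_measurable M) \<and>
     (\<forall>\<epsilon>>0. (\<lambda>n. measure M {\<omega> \<in> space M. \<bar>Z n \<omega> - c\<bar> > \<epsilon>}) \<longlonglongrightarrow> 0)"

lemma measurable_sarrd_depth:
  assumes U: "\<And>x p. p \<in> {1..k} \<Longrightarrow> U x p \<in> borel_measurable M"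
  shows "(\<lambda>\<omega>. sarrd_depth k (\<lambda>x p. U x p \<omega>) n) \<in> measurable M (count_space UNIV)"
proof -
  have "Measurable.pred M (\<lambda>\<omega>. (n, 0) \<in> sarrd_edges k (\<lambda>x p. U x p \<omega>) ^^ m)" for m n
  proof (induction m arbitrary: n)
    case 0
    then show ?case by simp
  next
    case (Suc m)
    have eq: "(n, 0) \<in> sarrd_edges k (\<lambda>x p. U x p \<omega>) ^^ Suc m \<longleftrightarrow>
        1 \<le> n \<and> (\<exists>p\<in>{1..k}. \<exists>y. y = nat \<lfloor>real n * U n p \<omega>\<rfloor> \<and>
          (y, 0) \<in> sarrd_edges k (\<lambda>x p. U x p \<omega>) ^^ m)" for \<omega>
    proof -
      let ?R = "sarrd_edges k (\<lambda>x p. U x p \<omega>)"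
      have "(n, 0) \<in> ?R ^^ Suc m \<longleftrightarrow> (\<exists>y. (n, y) \<in> ?R \<and> (y, 0) \<in> ?R ^^ m)"
        by (meson relpow_Suc_D2 relpow_Suc_I2)
      also have "\<dots> \<longleftrightarrow> (\<exists>y. (1 \<le> n \<and> (\<exists>p\<in>{1..k}. y = nat \<lfloor>real n * U n p \<omega>\<rfloor>)) \<and> (y, 0) \<in> ?R ^^ m)"
      proof -
        have "(n, y) \<in> ?R \<longleftrightarrow> 1 \<le> n \<and> (\<exists>p\<in>{1..k}. y = nat \<lfloor>real n * U n p \<omega>\<rfloor>)" for y
          by (auto simp: sarrd_edges_def)
        then show ?thesis by (simp only:)
      qed
      finally show ?thesis by blast
    qed
    have [measurable]: "Measurable.pred M (\<lambda>\<omega>. y = nat \<lfloor>real n * U n p \<omega>\<rfloor>)"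
      if "p \<in> {1..k}" for y p
      using U[OF that, of n] by measurable
    show ?case
      unfolding eq using Suc.IH by measurable
  qed
  then show ?thesis
    unfolding sarrd_depth_def by measurable
qed

end

theory Submission
  imports Defs "HOL-Real_Asymp.Real_Asymp"
begin

text \<open>
  Write \<open>L = ln X\<close>. For \<open>s > 0\<close> a union bound over the parents gives
  \<open>P (D\<^sub>n > m) \<le> n\<^sup>s (k E exp (s L))\<^sup>m\<close>, which is the upper bound.

  For the lower bound below \<open>1 / E (- L)\<close> it suffices to follow the first parents.
  Otherwise a node \<open>y\<close> that should have depth at least \<open>t\<close> gets the budget \<open>v = ln y - a t\<close>, and one looks for a
  decreasing function \<open>G\<close> of the budget with \<open>G = 1\<close> on negative budgets and \<open>(E G (v + a + L))\<^sup>k < G v\<close> on the others.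
  Then the probability that all nodes of a set fail is at most the product of their values of \<open>G\<close>, up to
  collisions of parents, which are rare because the density is bounded. Such a \<open>G = 1 - c g\<close> comes from a function \<open>g\<close>
  with \<open>k E g (v + a + L) > g v\<close>, an exponential times a quadratic: with the exponential tilt that centres
  \<open>a + L\<close>, the growth factor exceeds 1 by the assumption on the rate.
\<close>

subsection \<open>Depth as a recursion over parents\<close>

text \<open>Nodes share ancestors, so the ancestry of a node is no branching process and its parents
  do not fail independently. The order of the labels is the substitute: the row of the largest node
  is independent of everything below it, so nodes are expanded one at a time while a whole set of
  nodes is kept in view. Collisions are rare only relative to the size of this set and to the label,
  which is why the set is kept at order \<open>ln n\<close> and why the budget gives away
  \<open>ln B\<close> with \<open>B\<close> a small power of \<open>n\<close>; a set of
  \<open>N\<close> nodes is then already negligible, because \<open>n * q ^ N\<close> tends to 0.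

  The \<open>G\<close> obtained from \<open>g\<close> is bounded away from 0, so by itself it gives
  a deep path with positive probability only. Powers with \<open>k \<ge> 2\<close> push its limit at
  large budgets below any level; for \<open>k = 1\<close> the rate is the reciprocal mean and there
  is nothing above it to reach. The centring tilt exists because the drift \<open>a + E L\<close> is
  negative there. For slopes below the reciprocal mean the drift is positive, hence the separate
  argument along first parents.\<close>

text \<open>
  With \<open>z (x, p)\<close> the \<open>p\<close>-th parent of \<open>x\<close>, \<open>shallow k z t x\<close> says that the depth of \<open>x\<close> is less than \<open>t\<close>.
  Recursion on the bound \<open>t\<close> instead of on \<open>x\<close> makes this total for arbitrary \<open>z\<close>.
\<close>

primrec shallow :: "nat \<Rightarrow> (nat \<times> nat \<Rightarrow> nat) \<Rightarrow> nat \<Rightarrow> nat \<Rightarrow> bool" where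
  "shallow k z 0 x \<longleftrightarrow> False"
| "shallow k z (Suc t) x \<longleftrightarrow> x = 0 \<or> (\<forall>p\<in>{1..k}. shallow k z t (z (x, p)))"

text \<open>Descending from a node below \<open>x\<close> never leaves the nodes below
  \<open>x\<close>, so only their rows are read. This gives the independence of row \<open>x\<close>
  from all depths beneath it, and later the passage from truncated to true parents.\<close>

lemma shallow_cong:
  assumes "\<And>y p. y < x \<Longrightarrow> p \<in> {1..k} \<Longrightarrow> z (y, p) = z' (y, p)"
    and "\<And>y p. 0 < y \<Longrightarrow> y < x \<Longrightarrow> p \<in> {1..k} \<Longrightarrow> z (y, p) < y"
    and "y < x"
  shows "shallow k z t y \<longleftrightarrow> shallow k z' t y"
  using assms(3)
proof (induction t arbitrary: y)
  case (Suc t)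
  show ?case
  proof (cases "y = 0")
    case False
    have "shallow k z t (z (y, p)) \<longleftrightarrow> shallow k z' t (z' (y, p))" if p: "p \<in> {1..k}" for p
      using assms(1)[OF Suc.prems p] assms(2)[OF _ Suc.prems p] False Suc.prems Suc.IH[of "z (y, p)"]
      by simp
    then show ?thesis by simp
  qed simp
qed simp

lemma sarrd_edges_iff:
  "(n, y) \<in> sarrd_edges k u \<longleftrightarrow> 1 \<le> n \<and> (\<exists>p\<in>{1..k}. y = nat \<lfloor>real n * u n p\<rfloor>)"
  by (auto simp: sarrd_edges_def)

lemma parent_less:
  assumes "1 \<le> (x::nat)" "0 < u" "u < 1"
  shows "nat \<lfloor>real x * u\<rfloor> < x"
proof -
  have "real x * u < real x" using assms by simp
  then have "\<lfloor>real x * u\<rfloor> < int x" by (simp add: floor_less_iff)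
  then show ?thesis using assms by linarith
qed

context
  fixes k :: nat and u :: "nat \<Rightarrow> nat \<Rightarrow> real"
  assumes k: "1 \<le> k" and u: "\<And>x p. p \<in> {1..k} \<Longrightarrow> 0 < u x p \<and> u x p < 1"
begin

lemma sarrd_path_exists: "\<exists>m. (n, 0) \<in> sarrd_edges k u ^^ m"
proof (induction n rule: less_induct)
  case (less n)
  show ?case
  proof (cases "n = 0")
    case True
    then have "(n, 0) \<in> sarrd_edges k u ^^ 0" by simp
    then show ?thesis ..
  next
    case False
    let ?y = "nat \<lfloor>real n * u n 1\<rfloor>"
    have "(n, ?y) \<in> sarrd_edges k u" using False k by (force simp: sarrd_edges_iff)
    moreover have "?y < n" using parent_less[of n "u n 1"] False u[of 1] k by auto
    ultimately show ?thesis using less.IH relpow_Suc_I2 by metis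
  qed
qed

lemma sarrd_path_length: "(n, y) \<in> sarrd_edges k u ^^ m \<Longrightarrow> y + m \<le> n"
proof (induction m arbitrary: y)
  case (Suc m)
  then obtain w where w: "(n, w) \<in> sarrd_edges k u ^^ m" "(w, y) \<in> sarrd_edges k u" by auto
  then have "y < w" using parent_less u by (auto simp: sarrd_edges_iff)
  then show ?case using Suc.IH[OF w(1)] by simp
qed simp

text \<open>Induction on \<open>t\<close>, splitting off the first edge of the path. For
  \<open>t = 0\<close> both sides fail, since some path always exists. The root has no outgoing
  edge, which is the disjunct \<open>x = 0\<close> of \<open>shallow\<close>.\<close>

lemma sarrd_depth_less_iff:
  "sarrd_depth k u n < t \<longleftrightarrow> shallow k (\<lambda>(x, p). nat \<lfloor>real x * u x p\<rfloor>) t n"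
proof -
  let ?E = "sarrd_edges k u" and ?z = "\<lambda>(x, p). nat \<lfloor>real x * u x p\<rfloor>"
  have "{m. (n, 0) \<in> ?E ^^ m} \<subseteq> {..n}" using sarrd_path_length by fastforce
  then have "finite {m. (n, 0) \<in> ?E ^^ m}" by (rule finite_subset) simp
  then have "sarrd_depth k u n < t \<longleftrightarrow> (\<forall>m. (n, 0) \<in> ?E ^^ m \<longrightarrow> m < t)"
    using sarrd_path_exists unfolding sarrd_depth_def by (subst Max_less_iff) auto
  also have "\<dots> \<longleftrightarrow> shallow k ?z t n"
  proof (induction t arbitrary: n)
    case 0
    show ?case using sarrd_path_exists by simp
  next
    case (Suc t)
    have "(\<forall>m. (n, 0) \<in> ?E ^^ m \<longrightarrow> m < Suc t) \<longleftrightarrow> (\<forall>m. (n, 0) \<in> ?E ^^ Suc m \<longrightarrow> m < t)"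
      by (metis Suc_less_eq lessI less_Suc_eq_0_disj not0_implies_Suc)
    also have "\<dots> \<longleftrightarrow> (\<forall>m y. (n, y) \<in> ?E \<longrightarrow> (y, 0) \<in> ?E ^^ m \<longrightarrow> m < t)"
      by (meson relpow_Suc_D2 relpow_Suc_I2)
    also have "\<dots> \<longleftrightarrow> (\<forall>y. (n, y) \<in> ?E \<longrightarrow> shallow k ?z t y)" using Suc.IH by blast
    also have "\<dots> \<longleftrightarrow> shallow k ?z (Suc t) n" by (auto simp: sarrd_edges_iff)
    finally show ?case .
  qed
  finally show ?thesis .
qed

end

subsection \<open>Independent rows of parents\<close>

text \<open>Only countably many functions map a finite set into \<open>nat\<close>, so the
  singletons generate everything. Finite blocks of parents thereby become discrete random variables
  on which every predicate is measurable.\<close>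

lemma sets_PiM_count_space:
  assumes "finite K"
  shows "sets (PiM K (\<lambda>_. count_space (UNIV :: nat set))) = Pow (PiE K (\<lambda>_. UNIV))"
proof (intro equalityI subsetI)
  fix A assume "A \<in> sets (PiM K (\<lambda>_. count_space (UNIV :: nat set)))"
  from sets.sets_into_space[OF this] show "A \<in> Pow (PiE K (\<lambda>_. UNIV))" by (simp add: space_PiM)
next
  fix A assume A: "A \<in> Pow (PiE K (\<lambda>_. UNIV :: nat set))"
  have "countable A" by (rule countable_subset[OF _ countable_PiE[of K "\<lambda>_. UNIV"]]) (use A assms in auto)
  moreover have "{h} \<in> sets (PiM K (\<lambda>_. count_space (UNIV :: nat set)))" if "h \<in> A" for h
  proof -
    have "{h} = PiE K (\<lambda>i. {h i})" using that A by (intro PiE_singleton[symmetric]) (auto simp: PiE_iff)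
    then show ?thesis using sets_PiM_I_finite[OF assms, of "\<lambda>i. {h i}" "\<lambda>_. count_space UNIV"] by simp
  qed
  ultimately have "(\<Union>h\<in>A. {h}) \<in> sets (PiM K (\<lambda>_. count_space (UNIV :: nat set)))"
    by (intro sets.countable_UN'') auto
  then show "A \<in> sets (PiM K (\<lambda>_. count_space (UNIV :: nat set)))" by simp
qed

text \<open>Freeze \<open>V\<close> and integrate it out: independence makes the joint law a
  product, and Fubini applies. Countability of \<open>S\<close> makes an arbitrary \<open>H\<close>
  jointly measurable.\<close>

lemma (in prob_space) indep_var_prob_le:
  assumes ind: "indep_var (count_space S) V (count_space T) W" and S: "countable S"
    and H: "\<And>v. v \<in> S \<Longrightarrow> prob {\<omega>\<in>space M. H v (W \<omega>)} \<le> b v"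
    and b: "integrable M (\<lambda>\<omega>. b (V \<omega>))"
  shows "prob {\<omega>\<in>space M. H (V \<omega>) (W \<omega>)} \<le> (\<integral>\<omega>. b (V \<omega>) \<partial>M)"
proof -
  have V[measurable]: "V \<in> measurable M (count_space S)" and W[measurable]: "W \<in> measurable M (count_space T)"
    using indep_var_rv1[OF ind] indep_var_rv2[OF ind] by auto
  have nonneg: "0 \<le> b (V \<omega>)" if "\<omega> \<in> space M" for \<omega>
  proof -
    have "V \<omega> \<in> S" using measurable_space[OF V that] by simp
    from H[OF this] show ?thesis by (rule order_trans[OF measure_nonneg])
  qed
  interpret W: prob_space "distr M (count_space T) W" by (rule prob_space_distr) fact
  let ?A = "{p \<in> space (count_space S \<Otimes>\<^sub>M count_space T). H (fst p) (snd p)}"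
  have A: "?A \<in> sets (count_space S \<Otimes>\<^sub>M count_space T)"
  proof -
    have "(\<lambda>p. H (fst p) (snd p)) \<in> measurable (count_space S \<Otimes>\<^sub>M count_space T) (count_space UNIV)"
      by (rule measurable_pair_measure_countable1[OF S]) simp
    then show ?thesis by (rule measurable_sets_Collect[where P="\<lambda>b. b"]) (simp add: )
  qed
  have "{\<omega>\<in>space M. H (V \<omega>) (W \<omega>)} = (\<lambda>\<omega>. (V \<omega>, W \<omega>)) -` ?A \<inter> space M"
    using measurable_space[OF V] measurable_space[OF W] by (auto simp: space_pair_measure)
  then have "emeasure M {\<omega>\<in>space M. H (V \<omega>) (W \<omega>)}
      = emeasure (distr M (count_space S \<Otimes>\<^sub>M count_space T) (\<lambda>\<omega>. (V \<omega>, W \<omega>))) ?A"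
    using A by (simp add: emeasure_distr)
  also have "\<dots> = emeasure (distr M (count_space S) V \<Otimes>\<^sub>M distr M (count_space T) W) ?A"
    using ind by (simp add: indep_var_distribution_eq)
  also have "\<dots> = (\<integral>\<^sup>+v. emeasure (distr M (count_space T) W) (Pair v -` ?A) \<partial>distr M (count_space S) V)"
    by (rule W.emeasure_pair_measure_alt) (use A in simp)
  also have "\<dots> \<le> (\<integral>\<^sup>+v. ennreal (b v) \<partial>distr M (count_space S) V)"
  proof (rule nn_integral_mono)
    fix v assume "v \<in> space (distr M (count_space S) V)"
    then have v: "v \<in> S" by simp
    have sub: "Pair v -` ?A \<subseteq> T" by (auto simp: space_pair_measure)
    have "emeasure (distr M (count_space T) W) (Pair v -` ?A) = emeasure M (W -` (Pair v -` ?A) \<inter> space M)"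
      using sub by (subst emeasure_distr) auto
    also have "W -` (Pair v -` ?A) \<inter> space M = {\<omega>\<in>space M. H v (W \<omega>)}"
      using v measurable_space[OF W] by (auto simp: space_pair_measure)
    also have "emeasure M \<dots> \<le> ennreal (b v)"
      using H[OF v] by (simp add: emeasure_eq_measure ennreal_leI)
    finally show "emeasure (distr M (count_space T) W) (Pair v -` ?A) \<le> ennreal (b v)" .
  qed
  also have "\<dots> = (\<integral>\<^sup>+\<omega>. ennreal (b (V \<omega>)) \<partial>M)" by (subst nn_integral_distr) auto
  also have "\<dots> = ennreal (\<integral>\<omega>. b (V \<omega>) \<partial>M)"
    by (rule nn_integral_eq_integral[OF b]) (auto intro: nonneg)
  finally show ?thesis
    using Bochner_Integration.integral_nonneg[of M "\<lambda>\<omega>. b (V \<omega>)"] nonneg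
    by (simp add: emeasure_eq_measure)
qed

text \<open>Parents decrease at every \<open>\<omega>\<close>, not just almost surely. Functions of
  a row then take finitely many values and are integrable, and statements about smaller labels hold
  pointwise.\<close>

locale random_parents = prob_space M for M :: "'a measure" +
  fixes k :: nat and Z :: "nat \<times> nat \<Rightarrow> 'a \<Rightarrow> nat"
  assumes k: "1 \<le> k"
    and indep: "indep_vars (\<lambda>_. count_space UNIV) Z (UNIV \<times> {1..k})"
    and Z_less: "0 < x \<Longrightarrow> p \<in> {1..k} \<Longrightarrow> Z (x, p) \<omega> < x"
begin

definition sh :: "nat \<Rightarrow> nat \<Rightarrow> 'a \<Rightarrow> bool" where
  "sh t x \<omega> \<longleftrightarrow> shallow k (\<lambda>i. Z i \<omega>) t x"

lemma sh_0 [simp]: "\<not> sh 0 x \<omega>"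
  and sh_Suc: "sh (Suc t) x \<omega> \<longleftrightarrow> x = 0 \<or> (\<forall>p\<in>{1..k}. sh t (Z (x, p) \<omega>) \<omega>)"
  by (simp_all add: sh_def)

lemma Z_measurable [measurable]: "p \<in> {1..k} \<Longrightarrow> Z (x, p) \<in> measurable M (count_space UNIV)"
  using indep by (auto simp: indep_vars_def)

lemma pred_sh [measurable]: "Measurable.pred M (sh t x)"
proof (induction t arbitrary: x)
  case (Suc t)
  note Suc [measurable]
  have "Measurable.pred M (\<lambda>\<omega>. sh t (Z (x, p) \<omega>) \<omega>)" if p: "p \<in> {1..k}" for p
  proof -
    note Z_measurable[OF p, measurable]
    have "Measurable.pred M (\<lambda>\<omega>. \<exists>y. Z (x, p) \<omega> = y \<and> sh t y \<omega>)" by measurable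
    then show ?thesis by simp
  qed
  note this [measurable]
  have "Measurable.pred M (\<lambda>\<omega>. x = 0 \<or> (\<forall>p\<in>{1..k}. sh t (Z (x, p) \<omega>) \<omega>))" by measurable
  then show ?case unfolding sh_Suc .
next
  case 0
  have "sh 0 x = (\<lambda>_. False)" by (simp add: fun_eq_iff)
  then show ?case by simp
qed

lemma integrable_row:
  fixes b :: "(nat \<Rightarrow> nat) \<Rightarrow> real"
  assumes x: "0 < x"
  shows "integrable M (\<lambda>\<omega>. b (\<lambda>p\<in>{1..k}. Z (x, p) \<omega>))"
proof (rule integrable_const_bound)
  let ?R = "PiE {1..k} (\<lambda>_. {..<x})"
  show "AE \<omega> in M. norm (b (\<lambda>p\<in>{1..k}. Z (x, p) \<omega>)) \<le> (\<Sum>r\<in>?R. \<bar>b r\<bar>)"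
    by (intro AE_I2 order_trans[OF _ member_le_sum[of "\<lambda>p\<in>{1..k}. Z (x, p) _" ?R "\<lambda>r. \<bar>b r\<bar>"]])
       (use Z_less[OF x] in \<open>auto intro!: finite_PiE\<close>)
  have "(\<lambda>\<omega>. \<lambda>p\<in>{1..k}. Z (x, p) \<omega>) \<in> measurable M (PiM {1..k} (\<lambda>_. count_space UNIV))"
    by (intro measurable_restrict Z_measurable)
  also have "measurable M (PiM {1..k} (\<lambda>_. count_space UNIV)) = measurable M (count_space (PiE {1..k} (\<lambda>_. UNIV :: nat set)))"
    by (intro measurable_cong_sets) (simp_all add: sets_PiM_count_space)
  finally show "(\<lambda>\<omega>. b (\<lambda>p\<in>{1..k}. Z (x, p) \<omega>)) \<in> borel_measurable M"
    by (rule measurable_compose) simp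
qed

lemma integrable_Z:
  fixes g :: "nat \<Rightarrow> real"
  assumes "0 < x" "p \<in> {1..k}"
  shows "integrable M (\<lambda>\<omega>. g (Z (x, p) \<omega>))"
  using integrable_row[OF assms(1), of "\<lambda>r. g (r p)"] assms(2) by simp

text \<open>The second argument of \<open>H\<close> is cut off at labels below \<open>x\<close>, so
  it is a function of the rows below \<open>x\<close>, which are independent of row
  \<open>x\<close>; the row may therefore be frozen. Every expansion of a node goes through
  this.\<close>

lemma prob_row_le:
  assumes x: "0 < x"
    and H: "\<And>r. prob {\<omega>\<in>space M. H r (\<lambda>y t. y < x \<and> sh t y \<omega>)} \<le> b r"
  shows "prob {\<omega>\<in>space M. H (\<lambda>p\<in>{1..k}. Z (x, p) \<omega>) (\<lambda>y t. y < x \<and> sh t y \<omega>)}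
     \<le> (\<integral>\<omega>. b (\<lambda>p\<in>{1..k}. Z (x, p) \<omega>) \<partial>M)"
proof -
  let ?J = "{x} \<times> {1..k}" and ?K = "{..<x} \<times> {1..k}" and ?C = "\<lambda>_. count_space (UNIV :: nat set)"
  let ?V = "\<lambda>\<omega>. restrict (\<lambda>i. Z i \<omega>) ?J" and ?W = "\<lambda>\<omega>. restrict (\<lambda>i. Z i \<omega>) ?K"
  let ?row = "\<lambda>v::nat \<times> nat \<Rightarrow> nat. \<lambda>p\<in>{1..k}. v (x, p)"
  let ?bel = "\<lambda>w y t. y < x \<and> shallow k w t y"
  have "indep_var (PiM ?J ?C) ?V (PiM ?K ?C) ?W"
    by (rule indep_var_restrict[OF indep]) auto
  from indep_var_compose[OF this, of "\<lambda>v. v" "count_space (PiE ?J (\<lambda>_. UNIV))"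
      "\<lambda>v. v" "count_space (PiE ?K (\<lambda>_. UNIV))"]
  have ind: "indep_var (count_space (PiE ?J (\<lambda>_. UNIV))) ?V (count_space (PiE ?K (\<lambda>_. UNIV))) ?W"
    by (simp add: comp_def measurable_def sets_PiM_count_space space_PiM)
  have row: "?row (?V \<omega>) = (\<lambda>p\<in>{1..k}. Z (x, p) \<omega>)" for \<omega> by auto
  have bel: "?bel (?W \<omega>) = (\<lambda>y t. y < x \<and> sh t y \<omega>)" for \<omega>
  proof -
    have "shallow k (?W \<omega>) t y \<longleftrightarrow> sh t y \<omega>" if "y < x" for t y
      unfolding sh_def by (rule shallow_cong[OF _ _ that]) (use Z_less in auto)
    then show ?thesis by (auto simp: fun_eq_iff)
  qed
  show ?thesis
    using indep_var_prob_le[OF ind, where H="\<lambda>v w. H (?row v) (?bel w)" and b="\<lambda>v. b (?row v)"] H integrable_row[OF x]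
    unfolding row bel by (simp add: countable_PiE)
qed

text \<open>A shallow node has a shallow first parent, so a single line of descent suffices. At the
  root the event is certain for positive \<open>t\<close>, which is what \<open>b1\<close> accounts
  for.\<close>

lemma prob_sh_le:
  fixes b :: "nat \<Rightarrow> nat \<Rightarrow> real"
  assumes b1: "\<And>t. 1 \<le> b (Suc t) 0"
    and nonneg: "\<And>x. 0 \<le> b 0 x"
    and step: "\<And>t x. 0 < x \<Longrightarrow> (\<integral>\<omega>. b t (Z (x, 1) \<omega>) \<partial>M) \<le> b (Suc t) x"
  shows "prob {\<omega>\<in>space M. sh t x \<omega>} \<le> b t x"
proof (induction t arbitrary: x)
  case 0
  then show ?case using nonneg by simp
next
  case (Suc t)
  show ?case
  proof (cases "x = 0")
    case True
    then show ?thesis using b1[of t] prob_le_1 order_trans by blast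
  next
    case False
    have 1: "1 \<in> {1..k}" using k by simp
    have "prob {\<omega>\<in>space M. sh (Suc t) x \<omega>} \<le> prob {\<omega>\<in>space M. Z (x, 1) \<omega> < x \<and> sh t (Z (x, 1) \<omega>) \<omega>}"
    proof (rule finite_measure_mono)
      show "{\<omega> \<in> space M. sh (Suc t) x \<omega>} \<subseteq> {\<omega> \<in> space M. Z (x, 1) \<omega> < x \<and> sh t (Z (x, 1) \<omega>) \<omega>}"
        using False 1 Z_less[of x 1] by (auto simp: sh_Suc)
      have "{\<omega> \<in> space M. Z (x, 1) \<omega> < x \<and> sh t (Z (x, 1) \<omega>) \<omega>} =
          (\<Union>y<x. {\<omega> \<in> space M. Z (x, 1) \<omega> = y \<and> sh t y \<omega>})" by auto
      also have "\<dots> \<in> events" using Z_measurable[OF 1] by measurable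
      finally show "{\<omega> \<in> space M. Z (x, 1) \<omega> < x \<and> sh t (Z (x, 1) \<omega>) \<omega>} \<in> events" .
    qed
    also have "\<dots> \<le> (\<integral>\<omega>. b t (Z (x, 1) \<omega>) \<partial>M)"
    proof -
      have "prob {\<omega> \<in> space M. y < x \<and> sh t y \<omega>} \<le> b t y" for y
        by (rule order_trans[OF finite_measure_mono Suc.IH]) auto
      from prob_row_le[of x "\<lambda>r B. B (r 1) t" "\<lambda>r. b t (r 1)", OF _ this] show ?thesis
        using False 1 by simp
    qed
    also have "\<dots> \<le> b (Suc t) x" using step False by simp
    finally show ?thesis .
  qed
qed

text \<open>Union bound over the parents. The shift by one is due to \<open>sh 0\<close> never
  holding: the first informative level is 1, where exactly the nodes other than the root fail to be
  shallow.\<close>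

lemma prob_not_sh_le:
  fixes b :: "nat \<Rightarrow> nat \<Rightarrow> real"
  assumes nonneg: "\<And>t x. 0 \<le> b t x" and b0: "\<And>x. 0 < x \<Longrightarrow> 1 \<le> b 0 x"
    and step: "\<And>t x. 0 < x \<Longrightarrow> (\<Sum>p\<in>{1..k}. \<integral>\<omega>. b t (Z (x, p) \<omega>) \<partial>M) \<le> b (Suc t) x"
  shows "prob {\<omega>\<in>space M. \<not> sh (Suc t) x \<omega>} \<le> b t x"
proof (induction t arbitrary: x)
  case 0
  show ?case
  proof (cases "x = 0")
    case False
    then show ?thesis using b0[of x] prob_le_1 order_trans by blast
  qed (use nonneg in \<open>simp add: sh_Suc\<close>)
next
  case (Suc t)
  show ?case
  proof (cases "x = 0")
    case True
    then show ?thesis using nonneg by (simp add: sh_Suc)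
  next
    case False
    let ?A = "\<lambda>p. {\<omega>\<in>space M. Z (x, p) \<omega> < x \<and> \<not> sh (Suc t) (Z (x, p) \<omega>) \<omega>}"
    have meas: "?A p \<in> events" if p: "p \<in> {1..k}" for p
    proof -
      have "?A p = (\<Union>y<x. {\<omega> \<in> space M. Z (x, p) \<omega> = y \<and> \<not> sh (Suc t) y \<omega>})" by auto
      also have "\<dots> \<in> events" using Z_measurable[OF p] by measurable
      finally show ?thesis .
    qed
    have "prob {\<omega>\<in>space M. \<not> sh (Suc (Suc t)) x \<omega>} \<le> prob (\<Union>p\<in>{1..k}. ?A p)"
      using False meas Z_less[of x] by (intro finite_measure_mono sets.finite_UN) (auto simp: sh_Suc[of "Suc t"])
    also have "\<dots> \<le> (\<Sum>p\<in>{1..k}. prob (?A p))"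
      by (rule finite_measure_subadditive_finite) (use meas in auto)
    also have "\<dots> \<le> (\<Sum>p\<in>{1..k}. \<integral>\<omega>. b t (Z (x, p) \<omega>) \<partial>M)"
    proof (rule sum_mono)
      fix p assume p: "p \<in> {1..k}"
      have "prob {\<omega> \<in> space M. y < x \<and> \<not> (y < x \<and> sh (Suc t) y \<omega>)} \<le> b t y" for y
        by (rule order_trans[OF finite_measure_mono Suc.IH]) auto
      from prob_row_le[of x "\<lambda>r B. r p < x \<and> \<not> B (r p) (Suc t)" "\<lambda>r. b t (r p)", OF _ this]
      show "prob (?A p) \<le> (\<integral>\<omega>. b t (Z (x, p) \<omega>) \<partial>M)"
        using False p by (simp cong: conj_cong)
    qed
    also have "\<dots> \<le> b (Suc t) x" using step False by simp
    finally show ?thesis .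
  qed
qed

section \<open>Sets of nodes: products over a row, and collisions of parents\<close>

lemma expectation_prod_row:
  fixes g :: "nat \<Rightarrow> real"
  assumes "0 < x"
  shows "(\<integral>\<omega>. (\<Prod>p\<in>{1..k}. g (Z (x, p) \<omega>)) \<partial>M) = (\<Prod>p\<in>{1..k}. \<integral>\<omega>. g (Z (x, p) \<omega>) \<partial>M)"
proof -
  let ?J = "Pair x ` {1..k}"
  have "indep_vars (\<lambda>_. count_space UNIV) Z ?J" by (rule indep_vars_subset[OF indep]) auto
  then have "indep_vars (\<lambda>_. borel) (\<lambda>i \<omega>. g (Z i \<omega>)) ?J"
    by (rule indep_vars_compose2) simp
  moreover have "integrable M (\<lambda>\<omega>. g (Z i \<omega>))" if "i \<in> ?J" for i
    using that integrable_Z[OF assms] by auto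
  ultimately show ?thesis
    using indep_vars_lebesgue_integral[of ?J "\<lambda>i \<omega>. g (Z i \<omega>)"] by (simp add: prod.reindex inj_on_def)
qed

text \<open>Given the value of the second parent, the independent first one hits it with probability
  at most \<open>c\<close>.\<close>

lemma prob_collision:
  assumes "0 < x" and pp: "p \<in> {1..k}" "p' \<in> {1..k}" "p \<noteq> p'"
    and c: "\<And>y. prob {\<omega>\<in>space M. Z (x, p) \<omega> = y} \<le> c"
  shows "prob {\<omega>\<in>space M. Z (x, p) \<omega> = Z (x, p') \<omega>} \<le> c"
proof -
  note Z_measurable[OF pp(1), measurable] Z_measurable[OF pp(2), measurable]
  have c0: "0 \<le> c" using c[of 0] measure_nonneg order_trans by blast
  let ?A = "\<lambda>p y. {\<omega>\<in>space M. Z (x, p) \<omega> = y}"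
  have ev: "?A p y \<in> events" "?A p' y \<in> events" for y by measurable
  have ind: "prob (?A p y \<inter> ?A p' y) = prob (?A p y) * prob (?A p' y)" for y
  proof -
    have "prob (\<Inter>i\<in>{(x, p), (x, p')}. Z i -` {y} \<inter> space M) = (\<Prod>i\<in>{(x, p), (x, p')}. prob (Z i -` {y} \<inter> space M))"
      by (rule indep_varsD[OF indep]) (use pp in auto)
    moreover have "Z i -` {y} \<inter> space M = {\<omega>\<in>space M. Z i \<omega> = y}" for i by auto
    ultimately show ?thesis using pp by simp
  qed
  have "prob {\<omega>\<in>space M. Z (x, p) \<omega> = Z (x, p') \<omega>} \<le> prob (\<Union>y<x. ?A p y \<inter> ?A p' y)"
    using Z_less[OF assms(1) pp(1)] Z_less[OF assms(1) pp(2)] ev by (intro finite_measure_mono sets.finite_UN) auto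
  also have "\<dots> \<le> (\<Sum>y<x. prob (?A p y \<inter> ?A p' y))"
    by (rule finite_measure_subadditive_finite) (use ev in auto)
  also have "\<dots> \<le> (\<Sum>y<x. c * prob (?A p' y))"
    unfolding ind by (intro sum_mono mult_right_mono c) simp
  also have "\<dots> = c * prob (\<Union>y<x. ?A p' y)"
    unfolding sum_distrib_left[symmetric]
    by (subst finite_measure_finite_Union[symmetric]) (use ev in \<open>auto simp: disjoint_family_on_def\<close>)
  also have "\<dots> \<le> c * 1" by (intro mult_left_mono c0 prob_le_1)
  finally show ?thesis by simp
qed

text \<open>Union bound: \<open>k * N\<close> ways to hit \<open>A\<close> and at most
  \<open>k * k\<close> pairs of parents that may coincide.\<close>

lemma prob_bad_row:
  assumes x: "0 < x" and A: "finite A" "card A \<le> N"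
    and c: "\<And>p y. p \<in> {1..k} \<Longrightarrow> prob {\<omega>\<in>space M. Z (x, p) \<omega> = y} \<le> c"
  shows "prob {\<omega>\<in>space M. (\<exists>p\<in>{1..k}. Z (x, p) \<omega> \<in> A) \<or> \<not> inj_on (\<lambda>p. Z (x, p) \<omega>) {1..k}}
    \<le> real k * (real N + real k) * c"
proof -
  have c0: "0 \<le> c" using order_trans[OF measure_nonneg c[of 1 0]] k by simp
  let ?P = "{1..k} \<times> {1..k} - Id"
  let ?A = "\<lambda>(p, y). {\<omega>\<in>space M. Z (x, p) \<omega> = y}"
  let ?B = "\<lambda>(p, p'). {\<omega>\<in>space M. Z (x, p) \<omega> = Z (x, p') \<omega>}"
  have A_ev: "?A i \<in> events" if "i \<in> {1..k} \<times> A" for i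
    using that Z_measurable[of _ x] by (cases i) (auto simp: measurable_count_space_eq2_countable)
  have B_ev: "?B i \<in> events" if "i \<in> ?P" for i
  proof -
    obtain p p' where i: "i = (p, p')" by (cases i)
    then have [measurable]: "Z (x, p) \<in> measurable M (count_space UNIV)" "Z (x, p') \<in> measurable M (count_space UNIV)"
      using that by auto
    have "?B i = (\<Union>y. {\<omega>\<in>space M. Z (x, p) \<omega> = y \<and> Z (x, p') \<omega> = y})" unfolding i by auto
    also have "\<dots> \<in> events" by measurable
    finally show ?thesis .
  qed
  have bad: "{\<omega>\<in>space M. (\<exists>p\<in>{1..k}. Z (x, p) \<omega> \<in> A) \<or> \<not> inj_on (\<lambda>p. Z (x, p) \<omega>) {1..k}}
      = (\<Union>i\<in>{1..k} \<times> A. ?A i) \<union> (\<Union>i\<in>?P. ?B i)"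
    by (auto simp: inj_on_def)
  have "prob (\<Union>i\<in>{1..k} \<times> A. ?A i) \<le> (\<Sum>i\<in>{1..k} \<times> A. prob (?A i))"
    by (rule finite_measure_subadditive_finite) (use A A_ev in auto)
  also have "\<dots> \<le> (\<Sum>i\<in>{1..k} \<times> A. c)" using c by (intro sum_mono) auto
  also have "\<dots> = real k * real (card A) * c" by (simp add: card_cartesian_product)
  also have "\<dots> \<le> real k * real N * c" using A c0 by (intro mult_right_mono mult_left_mono) auto
  finally have 1: "prob (\<Union>i\<in>{1..k} \<times> A. ?A i) \<le> real k * real N * c" .
  have "prob (\<Union>i\<in>?P. ?B i) \<le> (\<Sum>i\<in>?P. prob (?B i))"
    by (rule finite_measure_subadditive_finite) (use B_ev in auto)
  also have "\<dots> \<le> (\<Sum>i\<in>?P. c)"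
  proof (rule sum_mono)
    fix i assume i: "i \<in> ?P"
    obtain p p' where "i = (p, p')" by (cases i)
    with i show "prob (?B i) \<le> c" using prob_collision[OF x, of p p' c] c by auto
  qed
  also have "\<dots> \<le> (\<Sum>i\<in>{1..k} \<times> {1..k}. c)" using c0 by (intro sum_mono2) auto
  also have "\<dots> = real k * real k * c" by (simp add: card_cartesian_product)
  finally have 2: "prob (\<Union>i\<in>?P. ?B i) \<le> real k * real k * c" .
  have "prob ((\<Union>i\<in>{1..k} \<times> A. ?A i) \<union> (\<Union>i\<in>?P. ?B i)) \<le> prob (\<Union>i\<in>{1..k} \<times> A. ?A i) + prob (\<Union>i\<in>?P. ?B i)"
    using A A_ev B_ev by (intro measure_Un_le sets.finite_UN) auto
  then show ?thesis unfolding bad using 1 2 by (simp add: algebra_simps)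
qed

text \<open>
  Expand the largest node of \<open>A\<close>. Its row is independent of all smaller nodes. Off the unlikely event that a
  parent repeats or hits \<open>A\<close>, the factor of the node is replaced by those of its parents; on this event
  the parents are discarded. Sets that outgrow \<open>N\<close> are cut down to \<open>N\<close> elements, whose product is at most \<open>q ^ N\<close>.
\<close>

lemma prob_all_sh_le:
  fixes \<phi> :: "nat \<Rightarrow> nat \<Rightarrow> real"
  assumes q: "0 \<le> q" and \<phi>: "\<And>t y. 0 \<le> \<phi> t y" "\<And>t y. \<phi> t y \<le> 1" "\<And>t y. \<phi> t y < 1 \<Longrightarrow> \<phi> t y \<le> q"
    and step: "\<And>t x. \<phi> (Suc t) x < 1 \<Longrightarrow> 0 < x \<and>
        (\<forall>p\<in>{1..k}. \<forall>y. prob {\<omega>\<in>space M. Z (x, p) \<omega> = y} \<le> c x) \<and>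
        (\<Prod>p\<in>{1..k}. \<integral>\<omega>. \<phi> t (Z (x, p) \<omega>) \<partial>M) + real k * (real N + real k) * c x \<le> \<phi> (Suc t) x"
  shows "A \<subseteq> {..<x} \<Longrightarrow> card A \<le> N \<Longrightarrow> (\<And>y. y \<in> A \<Longrightarrow> \<phi> (\<tau> y) y < 1) \<Longrightarrow>
    prob {\<omega>\<in>space M. \<forall>y\<in>A. sh (\<tau> y) y \<omega>} \<le> (\<Prod>y\<in>A. \<phi> (\<tau> y) y) + real x * q ^ N"
proof (induction x arbitrary: A \<tau>)
  case 0
  then show ?case by (simp add: prob_space)
next
  case (Suc x)
  have [simp]: "finite A" using Suc.prems(1) finite_subset by blast
  show ?case
  proof (cases "x \<in> A")
    case False
    then have "A \<subseteq> {..<x}" using Suc.prems(1) less_Suc_eq by auto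
    from Suc.IH[OF this Suc.prems(2,3)] have
      "prob {\<omega>\<in>space M. \<forall>y\<in>A. sh (\<tau> y) y \<omega>} \<le> (\<Prod>y\<in>A. \<phi> (\<tau> y) y) + real x * q ^ N" by simp
    also have "\<dots> \<le> (\<Prod>y\<in>A. \<phi> (\<tau> y) y) + real (Suc x) * q ^ N"
      using q by (intro add_left_mono mult_right_mono) auto
    finally show ?thesis .
  next
    case xA: True
    show ?thesis
    proof (cases "\<tau> x")
      case 0
      then have empty: "{\<omega>\<in>space M. \<forall>y\<in>A. sh (\<tau> y) y \<omega>} = {}" using xA by force
      show ?thesis unfolding empty using \<phi> q by (auto intro!: add_nonneg_nonneg prod_nonneg)
    next
      case (Suc t)
      let ?A = "A - {x}"
      have Ax: "?A \<subseteq> {..<x}" using Suc.prems(1) by fastforce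
      have cardA: "card ?A \<le> N" using Suc.prems(2) card_Diff1_le[of A x] by linarith
      have st: "0 < x" "\<And>p y. p\<in>{1..k} \<Longrightarrow> prob {\<omega>\<in>space M. Z (x, p) \<omega> = y} \<le> c x"
        "(\<Prod>p\<in>{1..k}. \<integral>\<omega>. \<phi> t (Z (x, p) \<omega>) \<partial>M) + real k * (real N + real k) * c x \<le> \<phi> (Suc t) x"
        using step[of t x] Suc.prems(3)[OF xA] Suc by auto
      define w where "w = (\<Prod>y\<in>?A. \<phi> (\<tau> y) y)"
      have w: "0 \<le> w" unfolding w_def using \<phi> by (intro prod_nonneg) auto
      define bad where "bad r \<longleftrightarrow> (\<exists>p\<in>{1..k}. r p \<in> ?A) \<or> \<not> inj_on r {1..k}" for r :: "nat \<Rightarrow> nat"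
      \<comment> \<open>A bound for the probability given the row \<open>r\<close> of
        \<open>x\<close>. Integrating it over the row produces the product of expectations and the
        probability of a bad row, exactly the two terms in \<open>step\<close>.\<close>
      define b where "b r = w * ((\<Prod>p\<in>{1..k}. \<phi> t (r p)) + of_bool (bad r)) + real (Suc x) * q ^ N" for r
      let ?H = "\<lambda>r B. (\<forall>p\<in>{1..k}. B (r p) t) \<and> (\<forall>y\<in>?A. B y (\<tau> y))"
      have H: "prob {\<omega>\<in>space M. ?H r (\<lambda>y t. y < x \<and> sh t y \<omega>)} \<le> b r" for r
      proof (cases "bad r")
        case True
        have "prob {\<omega>\<in>space M. ?H r (\<lambda>y t. y < x \<and> sh t y \<omega>)} \<le> prob {\<omega>\<in>space M. \<forall>y\<in>?A. sh (\<tau> y) y \<omega>}"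
          by (rule finite_measure_mono) auto
        also have "\<dots> \<le> w + real x * q ^ N"
          unfolding w_def using Suc.IH[OF Ax cardA] Suc.prems(3) by simp
        also have "\<dots> \<le> w * ((\<Prod>p\<in>{1..k}. \<phi> t (r p)) + 1) + real (Suc x) * q ^ N"
          using w \<phi> q by (intro add_mono mult_right_mono) (auto simp: distrib_left intro!: mult_nonneg_nonneg prod_nonneg)
        finally show ?thesis using True by (simp add: b_def)
      next
        case False
        then have inj: "inj_on r {1..k}" and disj: "r ` {1..k} \<inter> ?A = {}" by (auto simp: bad_def)
        \<comment> \<open>Parents with \<open>\<phi> = 1\<close> are dropped: they contribute the
          factor 1, and the induction hypothesis admits only nodes with
          \<open>\<phi> < 1\<close>.\<close>
        define S where "S = r ` {p\<in>{1..k}. \<phi> t (r p) < 1 \<and> r p < x}"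
        \<comment> \<open>Since \<open>r\<close> is not bad, \<open>S\<close> misses the old nodes,
          so assigning level \<open>t\<close> on \<open>S\<close> does not disturb their
          levels.\<close>
        define \<tau>' where "\<tau>' y = (if y \<in> S then t else \<tau> y)" for y
        have S: "finite S" "S \<inter> ?A = {}" "S \<subseteq> {..<x}" unfolding S_def using disj by (simp, blast, blast)
        show ?thesis
        proof (cases "r ` {1..k} \<subseteq> {..<x}")
          case False
          then have empty: "{\<omega>\<in>space M. ?H r (\<lambda>y t. y < x \<and> sh t y \<omega>)} = {}" by auto
          show ?thesis unfolding empty b_def using w \<phi> q
            by (auto intro!: add_nonneg_nonneg mult_nonneg_nonneg prod_nonneg)
        next
          case rx: True
          have lt: "\<phi> (\<tau>' y) y < 1" if "y \<in> ?A \<union> S" for y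
            using that Suc.prems(3) by (auto simp: \<tau>'_def S_def)
          have prod: "(\<Prod>y\<in>?A \<union> S. \<phi> (\<tau>' y) y) = w * (\<Prod>p\<in>{1..k}. \<phi> t (r p))"
          proof -
            have "(\<Prod>y\<in>?A. \<phi> (\<tau>' y) y) = w"
              unfolding w_def \<tau>'_def by (rule prod.cong) (use S in auto)
            moreover have "(\<Prod>y\<in>S. \<phi> (\<tau>' y) y) = (\<Prod>p\<in>{p\<in>{1..k}. \<phi> t (r p) < 1 \<and> r p < x}. \<phi> t (r p))"
              unfolding S_def
              by (subst prod.reindex) (auto simp: \<tau>'_def S_def intro: inj_on_subset[OF inj])
            moreover have "\<dots> = (\<Prod>p\<in>{1..k}. \<phi> t (r p))"
              using rx \<phi>(2) by (intro prod.mono_neutral_left) (auto simp: less_le)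
            ultimately show ?thesis using S by (subst prod.union_disjoint) auto
          qed
          have mono: "prob {\<omega>\<in>space M. ?H r (\<lambda>y t. y < x \<and> sh t y \<omega>)} \<le> prob {\<omega>\<in>space M. \<forall>y\<in>A'. sh (\<tau>' y) y \<omega>}"
            if A': "A' \<subseteq> ?A \<union> S" for A'
          proof (rule finite_measure_mono)
            show "{\<omega>\<in>space M. ?H r (\<lambda>y t. y < x \<and> sh t y \<omega>)} \<subseteq> {\<omega>\<in>space M. \<forall>y\<in>A'. sh (\<tau>' y) y \<omega>}"
              using A' S by (auto simp: \<tau>'_def S_def)
            have "finite A'" using A' S finite_subset[of A' "?A \<union> S"] by simp
            then show "{\<omega>\<in>space M. \<forall>y\<in>A'. sh (\<tau>' y) y \<omega>} \<in> events" by measurable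
          qed
          have "prob {\<omega>\<in>space M. ?H r (\<lambda>y t. y < x \<and> sh t y \<omega>)} \<le> w * (\<Prod>p\<in>{1..k}. \<phi> t (r p)) + real (Suc x) * q ^ N"
          proof (cases "card (?A \<union> S) \<le> N")
            case True
            have "prob {\<omega>\<in>space M. ?H r (\<lambda>y t. y < x \<and> sh t y \<omega>)} \<le> (\<Prod>y\<in>?A \<union> S. \<phi> (\<tau>' y) y) + real x * q ^ N"
              using mono[OF order_refl] Suc.IH[of "?A \<union> S" \<tau>', OF _ True lt] Ax S by force
            also have "\<dots> \<le> w * (\<Prod>p\<in>{1..k}. \<phi> t (r p)) + real (Suc x) * q ^ N"
              unfolding prod using q by (intro add_left_mono mult_right_mono) auto
            finally show ?thesis .
          next
            case False
            \<comment> \<open>Any \<open>N\<close> of the nodes will do, each factor being at most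
              \<open>q\<close>. The resulting extra \<open>q ^ N\<close> is what raises the error
              from \<open>real x\<close> to \<open>real (Suc x)\<close> copies.\<close>
            then obtain A' where A': "A' \<subseteq> ?A \<union> S" "card A' = N" "finite A'"
              using obtain_subset_with_card_n[of N "?A \<union> S"] S by auto
            have "prob {\<omega>\<in>space M. ?H r (\<lambda>y t. y < x \<and> sh t y \<omega>)} \<le> (\<Prod>y\<in>A'. \<phi> (\<tau>' y) y) + real x * q ^ N"
              using mono[OF A'(1)] Suc.IH[of A' \<tau>'] lt A' Ax S by force
            also have "(\<Prod>y\<in>A'. \<phi> (\<tau>' y) y) \<le> (\<Prod>y\<in>A'. q)"
              using lt A' \<phi> by (intro prod_mono) blast
            also have "(\<Prod>y\<in>A'. q) + real x * q ^ N = real (Suc x) * q ^ N"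
              using A' by (simp add: algebra_simps)
            also have "\<dots> \<le> w * (\<Prod>p\<in>{1..k}. \<phi> t (r p)) + real (Suc x) * q ^ N"
              using w \<phi> by (auto intro!: mult_nonneg_nonneg prod_nonneg)
            finally show ?thesis by simp
          qed
          then show ?thesis unfolding b_def using False by simp
        qed
      qed
      let ?r = "\<lambda>\<omega>. \<lambda>p\<in>{1..k}. Z (x, p) \<omega>"
      have "prob {\<omega>\<in>space M. \<forall>y\<in>A. sh (\<tau> y) y \<omega>} = prob {\<omega>\<in>space M. ?H (?r \<omega>) (\<lambda>y t. y < x \<and> sh t y \<omega>)}"
      proof -
        have "(\<forall>y\<in>A. sh (\<tau> y) y \<omega>) \<longleftrightarrow> ?H (?r \<omega>) (\<lambda>y t. y < x \<and> sh t y \<omega>)" for \<omega>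
        proof -
          have "(\<forall>y\<in>A. sh (\<tau> y) y \<omega>) \<longleftrightarrow> sh (Suc t) x \<omega> \<and> (\<forall>y\<in>?A. sh (\<tau> y) y \<omega>)"
            using xA Suc by auto
          then show ?thesis using Ax st(1) Z_less[OF st(1), of _ \<omega>] by (auto simp: sh_Suc)
        qed
        then show ?thesis by simp
      qed
      also have "\<dots> \<le> (\<integral>\<omega>. b (?r \<omega>) \<partial>M)" by (rule prob_row_le[OF st(1) H])
      also have "\<dots> = w * ((\<integral>\<omega>. (\<Prod>p\<in>{1..k}. \<phi> t (Z (x, p) \<omega>)) \<partial>M) + (\<integral>\<omega>. of_bool (bad (?r \<omega>)) \<partial>M)) + real (Suc x) * q ^ N"
      proof -
        have row: "(\<Prod>p\<in>{1..k}. \<phi> t (?r \<omega> p)) = (\<Prod>p\<in>{1..k}. \<phi> t (Z (x, p) \<omega>))" for \<omega>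
          by (rule prod.cong) auto
        show ?thesis
          unfolding b_def row using integrable_row[OF st(1), of "\<lambda>r. \<Prod>p\<in>{1..k}. \<phi> t (r p)"]
            integrable_row[OF st(1), of "\<lambda>r. of_bool (bad r)"]
          unfolding row by (simp add: prob_space)
      qed
      also have "(\<integral>\<omega>. of_bool (bad (?r \<omega>)) \<partial>M) \<le> real k * (real N + real k) * c x"
      proof -
        have badr: "bad (?r \<omega>) \<longleftrightarrow> (\<exists>p\<in>{1..k}. Z (x, p) \<omega> \<in> ?A) \<or> \<not> inj_on (\<lambda>p. Z (x, p) \<omega>) {1..k}" for \<omega>
          unfolding bad_def by (auto simp: inj_on_def)
        have "(\<integral>\<omega>. of_bool (bad (?r \<omega>)) \<partial>M) = (\<integral>\<omega>. indicat_real {\<omega>\<in>space M. bad (?r \<omega>)} \<omega> \<partial>M)"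
          by (rule Bochner_Integration.integral_cong) (auto simp: indicator_def)
        also have "\<dots> = prob {\<omega>\<in>space M. bad (?r \<omega>)}" by (simp add: Int_absorb2)
        also have "\<dots> \<le> real k * (real N + real k) * c x"
          unfolding badr by (rule prob_bad_row[OF st(1) _ cardA st(2)]) simp
        finally show ?thesis .
      qed
      also have "(\<integral>\<omega>. (\<Prod>p\<in>{1..k}. \<phi> t (Z (x, p) \<omega>)) \<partial>M) = (\<Prod>p\<in>{1..k}. \<integral>\<omega>. \<phi> t (Z (x, p) \<omega>) \<partial>M)"
        by (rule expectation_prod_row[OF st(1)])
      also have "w * ((\<Prod>p\<in>{1..k}. \<integral>\<omega>. \<phi> t (Z (x, p) \<omega>) \<partial>M) + real k * (real N + real k) * c x) \<le> w * \<phi> (Suc t) x"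
        by (intro mult_left_mono st w)
      also have "w * \<phi> (Suc t) x = (\<Prod>y\<in>A. \<phi> (\<tau> y) y)"
        unfolding w_def using xA Suc by (simp add: prod.remove[of A x])
      finally show ?thesis using w by (simp add: mult_left_mono)
    qed
  qed
qed

end

subsection \<open>Exponential tilting and the linear wave\<close>

locale bounded_density_attachment = prob_space M for M :: "'a measure" +
  fixes X :: "'a \<Rightarrow> real" and f :: "real \<Rightarrow> ennreal" and C :: real
  assumes X_AE: "AE \<omega> in M. X \<omega> \<in> {0<..<1}"
    and X_distr: "distributed M lborel X f"
    and f_le: "\<And>x. f x \<le> ennreal C"
begin

abbreviation L :: "'a \<Rightarrow> real" where "L \<omega> \<equiv> ln (X \<omega>)"

lemma X_measurable [measurable]: "X \<in> borel_measurable M"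
  using distributed_measurable[OF X_distr] by simp

lemma f_measurable [measurable]: "f \<in> borel_measurable borel"
  using distributed_borel_measurable[OF X_distr] by simp

section \<open>Moments supplied by the bounded density\<close>

lemma nn_integral_X_le:
  assumes [measurable]: "g \<in> borel_measurable borel"
  shows "(\<integral>\<^sup>+\<omega>. g (X \<omega>) \<partial>M) \<le> ennreal C * (\<integral>\<^sup>+x. g x \<partial>lborel)"
proof -
  have "(\<integral>\<^sup>+\<omega>. g (X \<omega>) \<partial>M) = (\<integral>\<^sup>+x. f x * g x \<partial>lborel)"
    by (rule distributed_nn_integral[OF X_distr, symmetric]) simp
  also have "\<dots> \<le> (\<integral>\<^sup>+x. ennreal C * g x \<partial>lborel)"
    by (intro nn_integral_mono mult_right_mono f_le) simp
  finally show ?thesis by (simp add: nn_integral_cmult)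
qed

lemma C_nonneg: "0 \<le> C"
proof (rule ccontr)
  assume "\<not> 0 \<le> C"
  then show False using nn_integral_X_le[of "\<lambda>_. 1"] by (simp add: ennreal_neg emeasure_space_1)
qed

lemma prob_interval_le:
  assumes "b \<le> c"
  shows "prob {\<omega>\<in>space M. b \<le> X \<omega> \<and> X \<omega> \<le> c} \<le> C * (c - b)"
proof -
  have "emeasure M {\<omega>\<in>space M. b \<le> X \<omega> \<and> X \<omega> \<le> c}
      = (\<integral>\<^sup>+\<omega>. indicator {\<omega>\<in>space M. b \<le> X \<omega> \<and> X \<omega> \<le> c} \<omega> \<partial>M)"
    by (rule nn_integral_indicator[symmetric]) measurable
  also have "\<dots> = (\<integral>\<^sup>+\<omega>. indicator {b..c} (X \<omega>) \<partial>M)"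
    by (intro nn_integral_cong) (auto split: split_indicator)
  also have "\<dots> \<le> ennreal C * (\<integral>\<^sup>+x. indicator {b..c} x \<partial>lborel)"
    by (rule nn_integral_X_le) simp
  also have "\<dots> = ennreal (C * (c - b))" using assms C_nonneg by (simp add: ennreal_mult)
  finally show ?thesis using assms C_nonneg by (simp add: emeasure_eq_measure)
qed

lemma L_neg: "AE \<omega> in M. L \<omega> < 0"
  using X_AE by eventually_elim simp

text \<open>The bounded density gives \<open>E X powr (- 1 / 2) \<le> 2 * C\<close>, since
  \<open>x powr (- 1 / 2)\<close> has integral 2 over the unit interval. The integrability of
  \<open>L\<close>, of its square and of the exponentials below is derived from this moment.\<close>

lemma integrable_exp_half: "integrable M (\<lambda>\<omega>. exp (- L \<omega> / 2))"
proof -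
  define g where "g = (\<lambda>x::real. x powr (- 1 / 2) * indicator {0..1} x)"
  have [measurable]: "g \<in> borel_measurable borel" unfolding g_def by measurable
  have "((\<lambda>x::real. x powr (- 1 / 2)) has_integral 2) {0..1}"
    using has_integral_powr_from_0[of "- 1 / 2" 1] by simp
  then have "(\<integral>\<^sup>+x. ennreal (indicator {0..1} x * (x powr (- 1 / 2))) \<partial>lborel) = ennreal 2"
    by (intro nn_integral_has_integral_lebesgue) auto
  then have fin: "(\<integral>\<^sup>+x. ennreal (g x) \<partial>lborel) = ennreal 2" by (simp add: g_def mult.commute)
  have "(\<integral>\<^sup>+\<omega>. ennreal (g (X \<omega>)) \<partial>M) \<le> ennreal C * ennreal 2"
    using nn_integral_X_le[of "\<lambda>x. ennreal (g x)"] fin by simp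
  then have "(\<integral>\<^sup>+\<omega>. ennreal (g (X \<omega>)) \<partial>M) < \<infinity>" by (simp add: ennreal_mult_less_top le_less_trans)
  moreover have "AE \<omega> in M. g (X \<omega>) = exp (- L \<omega> / 2)"
    using X_AE by eventually_elim (simp add: g_def powr_def)
  then have "(\<integral>\<^sup>+\<omega>. ennreal (g (X \<omega>)) \<partial>M) = (\<integral>\<^sup>+\<omega>. ennreal (exp (- L \<omega> / 2)) \<partial>M)"
    by (intro nn_integral_cong_AE) auto
  ultimately show ?thesis by (intro integrableI_nonneg) auto
qed

lemma integrable_exp_L:
  assumes "- 1 / 2 \<le> s"
  shows "integrable M (\<lambda>\<omega>. exp (s * L \<omega>))"
proof (rule Bochner_Integration.integrable_bound[OF integrable_exp_half])
  show "AE \<omega> in M. norm (exp (s * L \<omega>)) \<le> norm (exp (- L \<omega> / 2))"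
    using L_neg
  proof eventually_elim
    case (elim \<omega>)
    have "(s + 1 / 2) * L \<omega> \<le> 0" using assms elim by (intro mult_nonneg_nonpos) auto
    then show ?case by (simp add: algebra_simps)
  qed
qed simp

lemma integrable_L_sq: "integrable M (\<lambda>\<omega>. (L \<omega>)\<^sup>2)"
proof (rule Bochner_Integration.integrable_bound)
  show "integrable M (\<lambda>\<omega>. 8 * exp (- L \<omega> / 2))" using integrable_exp_half by simp
  show "AE \<omega> in M. norm ((L \<omega>)\<^sup>2) \<le> norm (8 * exp (- L \<omega> / 2))"
    using L_neg
  proof eventually_elim
    case (elim \<omega>)
    have "1 + (- L \<omega> / 2) + (- L \<omega> / 2)\<^sup>2 / 2 \<le> exp (- L \<omega> / 2)"
      by (rule exp_lower_Taylor_quadratic) (use elim in simp)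
    then show ?case using elim by (simp add: power2_eq_square)
  qed
qed simp

lemma integrable_L: "integrable M L"
  by (rule square_integrable_imp_integrable[OF _ integrable_L_sq]) simp

lemma expectation_exp_pos:
  assumes "integrable M (\<lambda>\<omega>. exp (h \<omega>) :: real)"
  shows "0 < (\<integral>\<omega>. exp (h \<omega>) \<partial>M)"
  using assms integral_less_AE_space[of "\<lambda>_. 0" "\<lambda>\<omega>. exp (h \<omega>)"] by (simp add: emeasure_space_1)

lemma expectation_L_neg: "(\<integral>\<omega>. L \<omega> \<partial>M) < 0"
  using integral_less_AE_space[of L "\<lambda>_. 0"] integrable_L L_neg by (simp add: emeasure_space_1)

lemma jensen_exp:
  assumes "integrable M (\<lambda>\<omega>. exp (s * L \<omega>))"
  shows "exp (s * (\<integral>\<omega>. L \<omega> \<partial>M)) \<le> (\<integral>\<omega>. exp (s * L \<omega>) \<partial>M)"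
proof -
  let ?m = "\<integral>\<omega>. L \<omega> \<partial>M"
  have "(\<integral>\<omega>. exp (s * ?m) * (1 + s * (L \<omega> - ?m)) \<partial>M) = exp (s * ?m)"
    using integrable_L by (simp add: prob_space algebra_simps)
  moreover have "(\<integral>\<omega>. exp (s * ?m) * (1 + s * (L \<omega> - ?m)) \<partial>M) \<le> (\<integral>\<omega>. exp (s * L \<omega>) \<partial>M)"
  proof (rule integral_mono[OF _ assms])
    show "integrable M (\<lambda>\<omega>. exp (s * ?m) * (1 + s * (L \<omega> - ?m)))"
      using integrable_L by simp
    fix \<omega>
    have "exp (s * ?m) * (1 + s * (L \<omega> - ?m)) \<le> exp (s * ?m) * exp (s * (L \<omega> - ?m))"
      by (intro mult_left_mono exp_ge_add_one_self) simp
    then show "exp (s * ?m) * (1 + s * (L \<omega> - ?m)) \<le> exp (s * L \<omega>)"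
      by (simp add: exp_add[symmetric] algebra_simps)
  qed
  ultimately show ?thesis by simp
qed

section \<open>Exponentially tilted moments of the increment\<close>

lemma exp_tilt_le:
  assumes "0 \<le> r"
  shows "AE \<omega> in M. exp (r * (a + L \<omega>)) \<le> exp (r * a)"
  using L_neg by eventually_elim (use assms in \<open>simp add: mult_left_mono\<close>)

lemma integrable_exp_tilt:
  assumes "0 \<le> r"
  shows "integrable M (\<lambda>\<omega>. exp (r * (a + L \<omega>)))"
  using integrable_exp_L[of r] assms by (simp add: exp_add distrib_left)

lemma integrable_tilt:
  assumes "0 \<le> r"
  shows "integrable M (\<lambda>\<omega>. (a + L \<omega>) * exp (r * (a + L \<omega>)))"
proof (rule Bochner_Integration.integrable_bound)
  show "integrable M (\<lambda>\<omega>. (a + L \<omega>) * exp (r * a))" using integrable_L by simp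
  show "AE \<omega> in M. norm ((a + L \<omega>) * exp (r * (a + L \<omega>))) \<le> norm ((a + L \<omega>) * exp (r * a))"
    using exp_tilt_le[OF assms, of a] by eventually_elim (simp add: abs_mult mult_left_mono)
qed simp

lemma integrable_tilt_sq:
  assumes "0 \<le> r"
  shows "integrable M (\<lambda>\<omega>. (a + L \<omega>)\<^sup>2 * exp (r * (a + L \<omega>)))"
proof (rule Bochner_Integration.integrable_bound)
  show "integrable M (\<lambda>\<omega>. (a + L \<omega>)\<^sup>2 * exp (r * a))"
    using integrable_L integrable_L_sq by (simp add: power2_sum)
  show "AE \<omega> in M. norm ((a + L \<omega>)\<^sup>2 * exp (r * (a + L \<omega>))) \<le> norm ((a + L \<omega>)\<^sup>2 * exp (r * a))"
    using exp_tilt_le[OF assms, of a] by eventually_elim (simp add: abs_mult mult_left_mono)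
qed simp

text \<open>For \<open>\<psi> r = E exp (r (a + L))\<close> this is the convexity bound
  \<open>\<psi> r \<le> \<psi> 0 + r * \<psi>' r\<close>. It serves twice: a value of
  \<open>\<psi>\<close> above 1 forces a positive derivative, and at a critical point
  \<open>\<psi>\<close> is at most 1.\<close>

lemma expectation_exp_tilt_le:
  assumes "0 \<le> r"
  shows "(\<integral>\<omega>. exp (r * (a + L \<omega>)) \<partial>M) \<le> 1 + r * (\<integral>\<omega>. (a + L \<omega>) * exp (r * (a + L \<omega>)) \<partial>M)"
proof -
  have "(\<integral>\<omega>. exp (r * (a + L \<omega>)) - r * ((a + L \<omega>) * exp (r * (a + L \<omega>))) \<partial>M) \<le> (\<integral>\<omega>. 1 \<partial>M)"
  proof (rule integral_mono)
    fix \<omega>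
    have "exp y * (1 - y) \<le> 1" for y :: real
      using mult_left_mono[OF exp_ge_add_one_self[of "- y"], of "exp y"] by (simp add: exp_minus)
    from this[of "r * (a + L \<omega>)"]
    show "exp (r * (a + L \<omega>)) - r * ((a + L \<omega>) * exp (r * (a + L \<omega>))) \<le> 1"
      by (simp only: right_diff_distrib mult_1_right mult_ac)
  qed (use integrable_tilt[OF assms] integrable_exp_tilt[OF assms] in auto)
  then show ?thesis
    using integrable_tilt[OF assms] integrable_exp_tilt[OF assms] by (simp add: prob_space)
qed

text \<open>The expectation in the conclusion is the derivative at \<open>r\<close> of \<open>\<lambda>r. E exp (r (a + L))\<close>.\<close>

lemma tilt_exists:
  assumes neg: "a + (\<integral>\<omega>. L \<omega> \<partial>M) < 0" and s: "0 < s" and large: "1 < (\<integral>\<omega>. exp (s * (a + L \<omega>)) \<partial>M)"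
  obtains r where "0 < r" "(\<integral>\<omega>. (a + L \<omega>) * exp (r * (a + L \<omega>)) \<partial>M) = 0"
proof -
  let ?x = "\<lambda>\<omega>. a + L \<omega>"
  let ?d = "\<lambda>r. \<integral>\<omega>. ?x \<omega> * exp (r * ?x \<omega>) \<partial>M"
  have dom: "AE \<omega> in M. norm (?x \<omega> * exp (r * ?x \<omega>)) \<le> \<bar>?x \<omega>\<bar> * exp (s * \<bar>a\<bar>)" if "0 \<le> r" "r \<le> s" for r
    using L_neg
  proof eventually_elim
    case (elim \<omega>)
    have "r * ?x \<omega> \<le> r * \<bar>a\<bar>" using elim that by (intro mult_left_mono) auto
    also have "\<dots> \<le> s * \<bar>a\<bar>" using that by (intro mult_right_mono) auto
    finally show ?case by (simp add: abs_mult mult_left_mono)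
  qed
  have int_dom: "integrable M (\<lambda>\<omega>. \<bar>?x \<omega>\<bar> * exp (s * \<bar>a\<bar>))" using integrable_L by simp
  have "continuous_on {0..s} ?d"
    unfolding continuous_on_sequentially
  proof safe
    fix u r assume u: "\<forall>n. u n \<in> {0..s}" and "r \<in> {0..s}" "u \<longlonglongrightarrow> r"
    show "(?d \<circ> u) \<longlonglongrightarrow> ?d r" unfolding comp_def
    proof (rule integral_dominated_convergence[OF _ _ int_dom])
      show "AE \<omega> in M. (\<lambda>n. ?x \<omega> * exp (u n * ?x \<omega>)) \<longlonglongrightarrow> ?x \<omega> * exp (r * ?x \<omega>)"
        using \<open>u \<longlonglongrightarrow> r\<close> by (intro AE_I2 tendsto_intros)
    qed (use u dom in auto)
  qed
  moreover have "?d 0 \<le> 0" using neg integrable_L by (simp add: prob_space)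
  \<comment> \<open>By convexity a value above 1 at \<open>s\<close> needs a positive slope there,
    while the slope at 0 is the negative drift; a zero lies in between.\<close>
  moreover have "0 \<le> ?d s"
  proof -
    have "0 < s * ?d s" using large expectation_exp_tilt_le[of s a] s by linarith
    then show ?thesis using s by (simp add: zero_less_mult_iff)
  qed
  ultimately obtain r where r: "0 \<le> r" "r \<le> s" "?d r = 0"
    using IVT'[of ?d 0 0 s] s by auto
  have "r \<noteq> 0" using r(3) neg integrable_L by (auto simp: prob_space)
  with r show ?thesis by (intro that[of r]) auto
qed

text \<open>
  Under the tilted law the increments are centred, so the quadratic \<open>Q\<close> loses only the constant \<open>m2\<close> per step,
  which the growth factor \<open>k * m0 > 1\<close> compensates where \<open>Q \<ge> c\<close>. Left of that region the floor \<open>\<epsilon>\<close>, small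
  compared with \<open>V\<close>, is regained by a single upward jump; on the right the supremum makes \<open>g\<close> monotone.
\<close>

lemma wave_exists:
  fixes a r k \<delta> :: real
  assumes r: "0 \<le> r" and E0: "(\<integral>\<omega>. (a + L \<omega>) * exp (r * (a + L \<omega>)) \<partial>M) = 0"
    and gt: "1 < k * (\<integral>\<omega>. exp (r * (a + L \<omega>)) \<partial>M)"
    and \<delta>: "0 < \<delta>" "0 < prob {\<omega>\<in>space M. \<delta> \<le> a + L \<omega>}"
  obtains g :: "real \<Rightarrow> real" and \<eta> \<epsilon> B where
    "mono g" "\<And>v. v < 0 \<Longrightarrow> g v = 0" "\<And>v. 0 \<le> v \<Longrightarrow> \<epsilon> \<le> g v" "\<And>v. g v \<le> B" "0 < \<epsilon>" "0 < \<eta>"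
    "\<And>v. 0 \<le> v \<Longrightarrow> (1 + \<eta>) * g v \<le> k * (\<integral>\<omega>. g (v + (a + L \<omega>)) \<partial>M)"
proof -
  let ?x = "\<lambda>\<omega>. a + L \<omega>"
  define m0 m2 where "m0 = (\<integral>\<omega>. exp (r * ?x \<omega>) \<partial>M)" and "m2 = (\<integral>\<omega>. (?x \<omega>)\<^sup>2 * exp (r * ?x \<omega>) \<partial>M)"
  define p where "p = prob {\<omega>\<in>space M. \<delta> \<le> a + L \<omega>}"
  \<comment> \<open>Here \<open>k * m0 = 1 + 2 * \<eta>\<close>: one \<open>\<eta>\<close> is kept
    as growth, the other pays the loss \<open>k * m2\<close>, which it can do exactly where
    \<open>Q\<close> is at least \<open>k * m2 / \<eta>\<close>.\<close>
  define \<eta> where "\<eta> = (k * m0 - 1) / 2"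
  define c where "c = k * m2 / \<eta> + 1"
  \<comment> \<open>Near the left root of \<open>Q\<close>, \<open>Q w < c\<close> forces
    \<open>w < 1\<close>, so \<open>exp (r * w) * Q w\<close> stays below this floor there.\<close>
  define \<epsilon> where "\<epsilon> = exp r * c"
  \<comment> \<open>The summand \<open>2 * c\<close> confines the points with
    \<open>0 < Q < c\<close> to distance 1 from the roots 0 and \<open>V\<close>;
    \<open>\<epsilon>\<close> makes \<open>Q (V - 1) = V - 1\<close> at least
    \<open>\<epsilon>\<close>; the last summand makes a jump of size \<open>\<delta>\<close> from
    the left end worth \<open>(1 + \<eta>) * \<epsilon>\<close> on average.\<close>
  define V where "V = 2 + 2 * c + \<epsilon> + \<delta> + (1 + \<eta>) * \<epsilon> / (k * p * \<delta>)"
  define Q where "Q u = u * (V - u)" for u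
  define S where "S v = insert \<epsilon> {exp (r * u) * Q u | u. u \<le> v \<and> c \<le> Q u}" for v
  define B where "B = max \<epsilon> (exp (r * V) * (V * V))"
  define g where "g v = (if v < 0 then 0 else Sup (S v))" for v :: real

  have m0: "0 \<le> m0" and m2: "0 \<le> m2" unfolding m0_def m2_def by (auto intro!: Bochner_Integration.integral_nonneg)
  have k: "0 < k" using gt m0 unfolding m0_def[symmetric]
    by (metis less_trans mult.commute mult_nonneg_nonpos not_less zero_less_one)
  have p: "0 < p" using \<delta> by (simp add: p_def)
  have \<eta>: "0 < \<eta>" using gt by (simp add: \<eta>_def m0_def)
  have c: "1 \<le> c" using k m2 \<eta> by (simp add: c_def)
  have c_le_\<epsilon>: "c \<le> \<epsilon>" using c r mult_right_mono[of 1 "exp r" c] by (simp add: \<epsilon>_def)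
  have \<epsilon>: "0 < \<epsilon>" using c c_le_\<epsilon> by simp
  have t0: "0 \<le> (1 + \<eta>) * \<epsilon> / (k * p * \<delta>)" using \<eta> \<epsilon> k p \<delta> by simp
  have V: "2 \<le> V" "2 * c \<le> V" "\<epsilon> \<le> V - 1" "\<delta> < V"
    using c \<epsilon> \<delta> t0 by (simp_all add: V_def)
  have V\<delta>: "(1 + \<eta>) * \<epsilon> \<le> k * p * (\<delta> * (V - \<delta>))"
  proof -
    have "(1 + \<eta>) * \<epsilon> / (k * p * \<delta>) \<le> V - \<delta>" using c \<epsilon> by (simp add: V_def)
    then show ?thesis using k p \<delta> by (simp add: pos_divide_le_eq mult_ac)
  qed

  have Qpos: "0 < u \<and> u < V" if "c \<le> Q u" for u
  proof -
    have "0 < u * (V - u)" using that c by (simp add: Q_def)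
    then show ?thesis using V(1) by (auto simp: zero_less_mult_iff)
  qed
  have S_le: "y \<le> B" if "y \<in> S v" for y v
  proof -
    have "exp (r * u) * Q u \<le> exp (r * V) * (V * V)" if u: "c \<le> Q u" for u
    proof (rule mult_mono)
      show "exp (r * u) \<le> exp (r * V)" using Qpos[OF u] r by (simp add: mult_left_mono)
      show "Q u \<le> V * V" unfolding Q_def using Qpos[OF u] by (intro mult_mono) auto
    qed (use u c in auto)
    then show ?thesis using that unfolding S_def B_def by fastforce
  qed
  have bdd: "bdd_above (S v)" for v using S_le by (auto simp: bdd_above_def)
  have S_g: "y \<le> g v" if "0 \<le> v" "y \<in> S v" for y v
    unfolding g_def using that bdd by (auto intro: cSup_upper)
  have \<epsilon>_g: "\<epsilon> \<le> g v" if "0 \<le> v" for v using S_g[OF that] by (simp add: S_def)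
  have g_le: "g v \<le> B" for v
    unfolding g_def using \<epsilon> S_le by (auto simp: B_def intro!: cSup_least) (auto simp: S_def)
  have g_nonneg: "0 \<le> g v" for v using \<epsilon>_g[of v] \<epsilon> by (cases "v < 0") (auto simp: g_def)
  have g_mono: "mono g"
  proof (rule monoI)
    fix v w :: real assume vw: "v \<le> w"
    show "g v \<le> g w"
    proof (cases "v < 0")
      case True
      then show ?thesis using g_nonneg[of w] by (simp add: g_def)
    next
      case False
      have "S v \<subseteq> S w" using vw by (auto simp: S_def)
      then have "Sup (S v) \<le> Sup (S w)" using bdd by (intro cSup_subset_mono) (auto simp: S_def)
      then show ?thesis using False vw by (simp add: g_def)
    qed
  qed
  note borel_measurable_mono[OF g_mono, measurable]
  have int_g: "integrable M (\<lambda>\<omega>. g (v + ?x \<omega>))" for v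
    by (rule integrable_const_bound[of _ B]) (use g_nonneg g_le in auto)
  \<comment> \<open>The comparison must also hold where \<open>Q < c\<close>, outside the points
    used to build \<open>S\<close>. Near 0 the floor \<open>\<epsilon>\<close> dominates; near
    \<open>V\<close> the value already collected at \<open>V - 1\<close> does, because
    \<open>exp (r * V) * c = exp (r * (V - 1)) * \<epsilon>\<close>.\<close>
  have key: "exp (r * w) * Q w \<le> g w" for w
  proof (cases "Q w \<le> 0")
    case True
    then have "exp (r * w) * Q w \<le> 0" by (intro mult_nonneg_nonpos) auto
    then show ?thesis using g_nonneg[of w] by simp
  next
    case False
    then have "0 < w * (V - w)" by (simp add: Q_def)
    then have w: "0 < w" "w < V" using V(1) by (auto simp: zero_less_mult_iff)
    consider "c \<le> Q w" | "Q w < c" "w \<le> V / 2" | "Q w < c" "V / 2 < w" by linarith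
    then show ?thesis
    proof cases
      case 1
      then show ?thesis using w by (intro S_g) (auto simp: S_def)
    next
      case 2
      have "w * c \<le> w * (V - w)" using w 2 V(2) by (intro mult_left_mono) auto
      then have "w * c < 1 * c" using 2 by (simp add: Q_def)
      then have "w < 1" using c by (simp add: mult_less_cancel_right)
      then have "r * w \<le> r" using r w by (simp add: mult_left_le)
      then have "exp (r * w) * Q w \<le> exp r * c" using 2 False by (intro mult_mono) auto
      then show ?thesis using \<epsilon>_g[of w] w by (simp add: \<epsilon>_def)
    next
      case 3
      have "c * (V - w) \<le> w * (V - w)" using w 3 V(2) by (intro mult_right_mono) auto
      then have "c * (V - w) < c * 1" using 3 by (simp add: Q_def)
      then have V1: "V - 1 < w" using c by (simp add: mult_less_cancel_left)
      have "exp (r * w) * Q w \<le> exp (r * V) * c"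
        using 3 False w r by (intro mult_mono) (auto intro: mult_left_mono)
      also have "\<dots> = exp (r * (V - 1)) * \<epsilon>" by (simp add: \<epsilon>_def exp_add[symmetric] algebra_simps)
      also have "\<dots> \<le> exp (r * (V - 1)) * Q (V - 1)" using V(3) by (simp add: Q_def)
      also have "\<dots> \<le> g w"
        using V1 V(3) c_le_\<epsilon> w by (intro S_g) (auto simp: S_def Q_def intro!: exI[of _ "V - 1"])
      finally show ?thesis .
    qed
  qed

  note int_e = integrable_exp_tilt[OF r, of a]
    and int_xe = integrable_tilt[OF r, of a] and int_xxe = integrable_tilt_sq[OF r, of a]
  have bulk: "(1 + \<eta>) * (exp (r * u) * Q u) \<le> k * (\<integral>\<omega>. g (u + ?x \<omega>) \<partial>M)" if u: "c \<le> Q u" for u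
  proof -
    have "k * m2 / \<eta> \<le> Q u" using u by (simp add: c_def)
    then have "k * m2 \<le> \<eta> * Q u" using \<eta> by (simp add: pos_divide_le_eq mult.commute)
    moreover have "k * m0 = 1 + 2 * \<eta>" by (simp add: \<eta>_def field_simps)
    ultimately have "(1 + \<eta>) * Q u \<le> k * m0 * Q u - k * m2" by (simp add: algebra_simps)
    then have "(1 + \<eta>) * (exp (r * u) * Q u) \<le> k * (exp (r * u) * (Q u * m0 - m2))"
      using mult_left_mono[of "(1 + \<eta>) * Q u" "k * m0 * Q u - k * m2" "exp (r * u)"]
      by (simp add: algebra_simps)
    \<comment> \<open>Expand \<open>Q (u + y) = Q u + (V - 2 * u) * y - y ^ 2\<close>; by
      \<open>E0\<close> the linear term vanishes under the tilt.\<close>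
    also have "exp (r * u) * (Q u * m0 - m2)
        = (\<integral>\<omega>. exp (r * u) * (Q u * exp (r * ?x \<omega>) + (V - 2 * u) * (?x \<omega> * exp (r * ?x \<omega>)) - (?x \<omega>)\<^sup>2 * exp (r * ?x \<omega>)) \<partial>M)"
      using int_e int_xe int_xxe by (simp add: m0_def m2_def E0)
    also have "\<dots> = (\<integral>\<omega>. exp (r * (u + ?x \<omega>)) * Q (u + ?x \<omega>) \<partial>M)"
    proof (rule Bochner_Integration.integral_cong[OF refl])
      fix \<omega>
      have "exp (r * (u + y)) * Q (u + y) = exp (r * u) * (Q u * exp (r * y) + (V - 2 * u) * (y * exp (r * y)) - y\<^sup>2 * exp (r * y))" for y
        unfolding distrib_left exp_add Q_def by (simp add: algebra_simps power2_eq_square)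
      then show "exp (r * u) * (Q u * exp (r * ?x \<omega>) + (V - 2 * u) * (?x \<omega> * exp (r * ?x \<omega>)) - (?x \<omega>)\<^sup>2 * exp (r * ?x \<omega>))
        = exp (r * (u + ?x \<omega>)) * Q (u + ?x \<omega>)" by simp
    qed
    also have "\<dots> \<le> (\<integral>\<omega>. g (u + ?x \<omega>) \<partial>M)"
      by (rule integral_mono'[OF int_g key g_nonneg])
    finally show ?thesis using k by simp
  qed
  have edge: "(1 + \<eta>) * \<epsilon> \<le> k * (\<integral>\<omega>. g (v + ?x \<omega>) \<partial>M)" if v: "0 \<le> v" for v
  proof -
    have "p * (\<delta> * (V - \<delta>)) \<le> p * g \<delta>"
    proof (rule mult_left_mono)
      have "1 * (\<delta> * (V - \<delta>)) \<le> exp (r * \<delta>) * (\<delta> * (V - \<delta>))"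
        using r \<delta> V by (intro mult_right_mono) auto
      then show "\<delta> * (V - \<delta>) \<le> g \<delta>" using key[of \<delta>] by (simp add: Q_def)
    qed (use p in simp)
    also have "\<dots> = (\<integral>\<omega>. indicat_real {\<omega>\<in>space M. \<delta> \<le> ?x \<omega>} \<omega> * g \<delta> \<partial>M)"
      by (simp add: p_def Int_absorb2)
    also have "\<dots> \<le> (\<integral>\<omega>. g (v + ?x \<omega>) \<partial>M)"
    proof (rule integral_mono'[OF int_g _ g_nonneg])
      fix \<omega> show "indicat_real {\<omega>\<in>space M. \<delta> \<le> ?x \<omega>} \<omega> * g \<delta> \<le> g (v + ?x \<omega>)"
        using g_nonneg monoD[OF g_mono, of \<delta> "v + ?x \<omega>"] v by (auto split: split_indicator)
    qed
    finally have "k * (p * (\<delta> * (V - \<delta>))) \<le> k * (\<integral>\<omega>. g (v + ?x \<omega>) \<partial>M)" using k by simp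
    then show ?thesis using V\<delta> by (simp add: mult.assoc)
  qed
  have "(1 + \<eta>) * g v \<le> k * (\<integral>\<omega>. g (v + ?x \<omega>) \<partial>M)" if v: "0 \<le> v" for v
  proof -
    have "y \<le> k * (\<integral>\<omega>. g (v + ?x \<omega>) \<partial>M) / (1 + \<eta>)" if "y \<in> S v" for y
      using that unfolding S_def
    proof safe
      show "\<epsilon> \<le> k * (\<integral>\<omega>. g (v + ?x \<omega>) \<partial>M) / (1 + \<eta>)"
        using edge[OF v] \<eta> by (simp add: pos_le_divide_eq mult.commute)
      fix u assume u: "u \<le> v" "c \<le> Q u"
      have "k * (\<integral>\<omega>. g (u + ?x \<omega>) \<partial>M) \<le> k * (\<integral>\<omega>. g (v + ?x \<omega>) \<partial>M)"
        using k u(1) by (intro mult_left_mono integral_mono int_g monoD[OF g_mono]) auto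
      then show "exp (r * u) * Q u \<le> k * (\<integral>\<omega>. g (v + ?x \<omega>) \<partial>M) / (1 + \<eta>)"
        using bulk[OF u(2)] \<eta> by (simp add: pos_le_divide_eq mult.commute)
    qed
    then have "Sup (S v) \<le> k * (\<integral>\<omega>. g (v + ?x \<omega>) \<partial>M) / (1 + \<eta>)"
      by (intro cSup_least) (auto simp: S_def)
    then show ?thesis using v \<eta> by (simp add: g_def pos_le_divide_eq mult.commute)
  qed
  then show ?thesis
    using that[OF g_mono _ \<epsilon>_g g_le \<epsilon> \<eta>] by (simp add: g_def)
qed

subsection \<open>Supersolutions\<close>

text \<open>
  \<open>G v\<close> bounds the probability that the subtree of a node with depth budget \<open>v\<close> fails to contain a long path.
  The slack \<open>\<kappa>\<close> and the lower bound \<open>\<beta>\<close> leave room for the collisions in \<open>prob_all_sh_le\<close>.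
\<close>

definition supersolution :: "real \<Rightarrow> nat \<Rightarrow> (real \<Rightarrow> real) \<Rightarrow> real \<Rightarrow> real \<Rightarrow> real \<Rightarrow> bool" where
  "supersolution a k G q \<beta> \<kappa> \<longleftrightarrow>
    antimono G \<and> (\<forall>v<0. G v = 1) \<and> (\<forall>v\<ge>0. G v \<le> q) \<and> (\<forall>v. \<beta> \<le> G v) \<and>
    (\<forall>v\<ge>0. (\<integral>\<omega>. G (v + (a + L \<omega>)) \<partial>M) ^ k \<le> (1 - \<kappa>) * G v) \<and>
    0 < q \<and> q < 1 \<and> 0 < \<beta> \<and> 0 < \<kappa>"

lemma supersolution_le_1:
  assumes "supersolution a k G q \<beta> \<kappa>"
  shows "G v \<le> 1"
  using assms unfolding supersolution_def by (cases "v < 0") (auto intro: order_trans[of _ q])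

lemma supersolution_pos:
  assumes "supersolution a k G q \<beta> \<kappa>"
  shows "0 < G v"
  using assms unfolding supersolution_def by (meson less_le_trans)

lemma antimono_measurable:
  fixes G :: "real \<Rightarrow> real"
  assumes "antimono G"
  shows "G \<in> borel_measurable borel"
proof -
  have "mono (\<lambda>v. - G v)" using assms by (auto simp: monotone_def)
  from borel_measurable_uminus[OF borel_measurable_mono[OF this]] show ?thesis by simp
qed

lemma supersolution_integrable:
  assumes "supersolution a k G q \<beta> \<kappa>"
  shows "integrable M (\<lambda>\<omega>. G (v + (b + L \<omega>)))"
proof -
  have [measurable]: "G \<in> borel_measurable borel"
    using assms by (intro antimono_measurable) (simp add: supersolution_def)
  show ?thesis
    by (rule integrable_const_bound[of _ 1])
       (use supersolution_le_1[OF assms] supersolution_pos[OF assms] in \<open>auto simp: less_imp_le\<close>)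
qed

text \<open>Linearise at the constant 1. With \<open>\<rho> = s * g v\<close> the
  \<open>k\<close>-th power is at most \<open>exp (- (1 + \<eta>) * \<rho>)\<close>, hence at most
  \<open>1 / (1 + (1 + \<eta>) * \<rho>)\<close>. Compared with \<open>1 - \<rho>\<close> this gains
  \<open>\<eta> * \<rho>\<close> and loses only a quadratic term, and the floor of \<open>g\<close>
  makes the gain uniform.\<close>

lemma supersolution_exists:
  fixes k :: nat
  assumes r: "0 \<le> r" and E0: "(\<integral>\<omega>. (a + L \<omega>) * exp (r * (a + L \<omega>)) \<partial>M) = 0"
    and gt: "1 < real k * (\<integral>\<omega>. exp (r * (a + L \<omega>)) \<partial>M)"
    and \<delta>: "0 < \<delta>" "0 < prob {\<omega>\<in>space M. \<delta> \<le> a + L \<omega>}"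
  shows "\<exists>G q \<beta> \<kappa>. supersolution a k G q \<beta> \<kappa>"
proof -
  obtain g \<eta> \<epsilon> B where g: "mono g" "\<And>v. v < 0 \<Longrightarrow> g v = 0" "\<And>v. 0 \<le> v \<Longrightarrow> \<epsilon> \<le> g v"
    "\<And>v. g v \<le> B" "0 < \<epsilon>" "0 < \<eta>"
    "\<And>v. 0 \<le> v \<Longrightarrow> (1 + \<eta>) * g v \<le> real k * (\<integral>\<omega>. g (v + (a + L \<omega>)) \<partial>M)"
    using wave_exists[OF assms, of thesis] by metis
  have g0: "0 \<le> g v" for v using g(2)[of v] g(3)[of v] g(5) by (cases "v < 0") auto
  have B: "0 < B" "\<epsilon> \<le> B" using g(3)[of 0] g(4)[of 0] g(5) by auto
  \<comment> \<open>The bound 1/2 keeps \<open>G\<close> away from 0; the other one makes the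
    quadratic loss \<open>(1 + \<eta>) * \<rho> ^ 2\<close> at most half of the gain
    \<open>\<eta> * \<rho>\<close>.\<close>
  define s where "s = min (1 / 2) (\<eta> / (2 * (1 + \<eta>))) / B"
  have s: "0 < s" using g(6) B by (simp add: s_def)
  have sB: "s * B = min (1 / 2) (\<eta> / (2 * (1 + \<eta>)))" using B by (simp add: s_def)
  have sB1: "s * B \<le> 1 / 2" unfolding sB by (rule min.cobounded1)
  have "s * B \<le> \<eta> / (2 * (1 + \<eta>))" unfolding sB by (rule min.cobounded2)
  then have sB2: "(1 + \<eta>) * (s * B) \<le> \<eta> / 2" using g(6) by (simp add: field_simps)
  have s\<epsilon>: "0 < s * \<epsilon>" "s * \<epsilon> \<le> 1 / 2"
    using s g(5) sB1 mult_left_mono[OF B(2), of s] by (simp, linarith)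
  have sg: "0 \<le> s * g v" "s * g v \<le> s * B" for v using s g0 g(4) by (auto intro: mult_left_mono)
  note borel_measurable_mono[OF g(1), measurable]
  have int_g: "integrable M (\<lambda>\<omega>. g (v + (a + L \<omega>)))" for v
    by (rule integrable_const_bound[of _ B]) (use g0 g(4) in auto)
  define G where "G v = 1 - s * g v" for v
  have G_half: "1 / 2 \<le> G v" for v using sg(2)[of v] sB1 unfolding G_def by linarith
  define x where "x = s * \<epsilon> * \<eta> / 2"
  have x: "0 < x" using s\<epsilon> g(6) by (simp add: x_def)
  have step: "(\<integral>\<omega>. G (v + (a + L \<omega>)) \<partial>M) ^ k \<le> (1 - x / (1 + x)) * G v" if v: "0 \<le> v" for v
  proof -
    define e where "e = s * (\<integral>\<omega>. g (v + (a + L \<omega>)) \<partial>M)"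
    define \<rho> where "\<rho> = s * g v"
    have \<rho>: "s * \<epsilon> \<le> \<rho>" "0 \<le> \<rho>" "\<rho> \<le> s * B" using g(3)[OF v] s sg by (auto simp: \<rho>_def)
    have pos: "0 < 1 + (1 + \<eta>) * \<rho>" using g(6) \<rho> by (simp add: add_pos_nonneg)
    have EG: "(\<integral>\<omega>. G (v + (a + L \<omega>)) \<partial>M) = 1 - e"
      using int_g by (simp add: G_def e_def prob_space)
    have "0 \<le> (\<integral>\<omega>. G (v + (a + L \<omega>)) \<partial>M)"
      by (intro Bochner_Integration.integral_nonneg order_trans[OF _ G_half]) simp
    then have "(1 - e) ^ k \<le> exp (- e) ^ k"
      using exp_ge_add_one_self[of "- e"] unfolding EG by (intro power_mono) auto
    also have "\<dots> = exp (- (real k * e))" by (simp add: exp_of_nat_mult[symmetric])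
    also have "\<dots> \<le> exp (- ((1 + \<eta>) * \<rho>))"
      using mult_left_mono[OF g(7)[OF v], of s] s by (simp add: e_def \<rho>_def mult_ac)
    also have "\<dots> \<le> 1 / (1 + (1 + \<eta>) * \<rho>)"
      using le_imp_inverse_le[OF exp_ge_add_one_self pos]
      by (simp only: exp_minus divide_inverse mult_1_left)
    also have "\<dots> \<le> (1 - x / (1 + x)) * (1 - \<rho>)"
    proof -
      have "(1 + \<eta>) * \<rho> \<le> \<eta> / 2"
        using mult_left_mono[OF \<rho>(3), of "1 + \<eta>"] g(6) sB2 by linarith
      then have "\<rho> * ((1 + \<eta>) * \<rho>) \<le> \<rho> * (\<eta> / 2)" using \<rho> by (intro mult_left_mono) auto
      moreover have "x \<le> \<rho> * (\<eta> / 2)"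
        using mult_right_mono[OF \<rho>(1), of "\<eta> / 2"] g(6) by (simp add: x_def)
      ultimately have "1 + x \<le> (1 - \<rho>) * (1 + (1 + \<eta>) * \<rho>)" by (simp add: algebra_simps)
      moreover have "1 - x / (1 + x) = 1 / (1 + x)" using x by (simp add: field_simps)
      ultimately show ?thesis using x pos by (simp add: pos_divide_le_eq pos_le_divide_eq mult.commute)
    qed
    finally show ?thesis unfolding EG by (simp add: G_def \<rho>_def)
  qed
  have "supersolution a k G (1 - s * \<epsilon>) (1 / 2) (x / (1 + x))"
    unfolding supersolution_def
  proof (intro conjI allI impI)
    show "antimono G" using g(1) s by (auto simp: G_def monotone_def intro!: mult_left_mono)
    show "1 / 2 \<le> G v" for v by (rule G_half)
    show "G v \<le> 1 - s * \<epsilon>" if "0 \<le> v" for v using g(3)[OF that] s by (simp add: G_def)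
  qed (use g(2) step s\<epsilon> x in \<open>auto simp: G_def\<close>)
  then show ?thesis by blast
qed

text \<open>A minimum of supersolutions is a supersolution, and far to the right the map
  \<open>G \<mapsto> (E G)^k\<close> squares the limit of \<open>G\<close>, so this limit can be lowered.\<close>

lemma supersolution_improve:
  assumes G: "supersolution a k G q \<beta> \<kappa>" and k: "2 \<le> k"
    and \<gamma>: "0 < \<gamma>" "\<gamma> < 1" "G V \<le> \<gamma>"
  shows "\<exists>G' q' \<beta>' \<kappa>' V'. supersolution a k G' q' \<beta>' \<kappa>' \<and> G' V' \<le> \<gamma> * ((1 + \<gamma>) / 2)"
proof -
  note G' = G[unfolded supersolution_def]
  define \<gamma>' where "\<gamma>' = \<gamma> * ((1 + \<gamma>) / 2)"
  have \<gamma>': "\<gamma> * \<gamma> < \<gamma>'" "\<gamma>' < 1" "0 < \<gamma>'"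
  proof -
    show "\<gamma> * \<gamma> < \<gamma>'" unfolding \<gamma>'_def using \<gamma> by (intro mult_strict_left_mono) auto
    show "\<gamma>' < 1" unfolding \<gamma>'_def using \<gamma> mult_strict_mono[of \<gamma> 1 "(1 + \<gamma>) / 2" 1] by simp
    show "0 < \<gamma>'" unfolding \<gamma>'_def using \<gamma> by simp
  qed
  \<comment> \<open>\<open>\<theta>\<close> exceeds \<open>\<gamma>\<close> while its square stays
    below \<open>\<gamma>'\<close>: the first gap absorbs the chance of a long downward jump, the
    second becomes the slack \<open>\<kappa>1\<close>.\<close>
  define \<theta> where "\<theta> = sqrt ((\<gamma> * \<gamma> + \<gamma>') / 2)"
  have \<theta>2: "\<theta>\<^sup>2 = (\<gamma> * \<gamma> + \<gamma>') / 2" using \<gamma>' \<gamma> by (simp add: \<theta>_def)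
  have \<theta>: "\<gamma> < \<theta>" "\<theta> < 1"
  proof -
    show "\<gamma> < \<theta>" unfolding \<theta>_def using \<gamma>' by (intro real_less_rsqrt) (simp add: power2_eq_square)
    show "\<theta> < 1" unfolding \<theta>_def using \<gamma>' by (simp add: real_sqrt_less_iff[of _ 1, simplified])
  qed
  define \<kappa>1 where "\<kappa>1 = 1 - \<theta>\<^sup>2 / \<gamma>'"
  have \<kappa>1: "0 < \<kappa>1" "(1 - \<kappa>1) * \<gamma>' = \<theta>\<^sup>2" using \<gamma>' \<theta>2 by (simp_all add: \<kappa>1_def)
  let ?x = "\<lambda>\<omega>. a + L \<omega>"
  define m where "m = (\<integral>\<omega>. \<bar>?x \<omega>\<bar> \<partial>M)"
  have m: "0 \<le> m" by (simp add: m_def)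
  define V' where "V' = max V 0 + 1 + m / (\<theta> - \<gamma>)"
  have V': "0 \<le> V'" "V < V'" "m / (V' - V) \<le> \<theta> - \<gamma>"
  proof -
    have *: "0 \<le> m / (\<theta> - \<gamma>)" using m \<theta> by simp
    show "0 \<le> V'" "V < V'" unfolding V'_def using * by auto
    have "m / (\<theta> - \<gamma>) \<le> V' - V" unfolding V'_def by simp
    then show "m / (V' - V) \<le> \<theta> - \<gamma>" using \<open>V < V'\<close> \<theta> by (simp add: field_simps)
  qed
  have tail: "(\<integral>\<omega>. G (v + ?x \<omega>) \<partial>M) ^ k \<le> (1 - \<kappa>1) * \<gamma>'" if v: "V' \<le> v" for v
  proof -
    \<comment> \<open>Markov in pointwise form: \<open>G\<close> can exceed \<open>\<gamma>\<close>
      only after a jump longer than \<open>v - V\<close>, and even then it is at most 1.\<close>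
    have "(\<integral>\<omega>. G (v + ?x \<omega>) \<partial>M) \<le> (\<integral>\<omega>. \<gamma> + \<bar>?x \<omega>\<bar> / (v - V) \<partial>M)"
    proof (rule integral_mono[OF supersolution_integrable[OF G]])
      show "integrable M (\<lambda>\<omega>. \<gamma> + \<bar>?x \<omega>\<bar> / (v - V))" using integrable_L by simp
      fix \<omega>
      show "G (v + ?x \<omega>) \<le> \<gamma> + \<bar>?x \<omega>\<bar> / (v - V)"
      proof (cases "V \<le> v + ?x \<omega>")
        case True
        then have "G (v + ?x \<omega>) \<le> \<gamma>" using antimonoD[OF conjunct1[OF G'] True] \<gamma>(3) by linarith
        moreover have "0 \<le> \<bar>?x \<omega>\<bar> / (v - V)" using v V' by simp
        ultimately show ?thesis by linarith
      next
        case False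
        then have "1 \<le> \<bar>?x \<omega>\<bar> / (v - V)" using v V' by (simp add: pos_le_divide_eq)
        then show ?thesis using supersolution_le_1[OF G, of "v + ?x \<omega>"] \<gamma>(1) by linarith
      qed
    qed
    also have "\<dots> = \<gamma> + m / (v - V)" using integrable_L by (simp add: m_def prob_space)
    also have "\<dots> \<le> \<theta>"
    proof -
      have "m / (v - V) \<le> m / (V' - V)" using m v V' by (intro divide_left_mono) auto
      then show ?thesis using V'(3) by linarith
    qed
    finally have "(\<integral>\<omega>. G (v + ?x \<omega>) \<partial>M) ^ k \<le> \<theta> ^ k"
      by (intro power_mono Bochner_Integration.integral_nonneg)
         (use supersolution_pos[OF G] in \<open>auto simp: less_imp_le\<close>)
    also have "\<dots> \<le> \<theta>\<^sup>2" using \<theta> \<gamma> k by (intro power_decreasing) auto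
    finally show ?thesis by (simp add: \<kappa>1(2))
  qed
  define H where "H v = (if v < V' then G v else min (G v) \<gamma>')" for v
  have HG: "H v \<le> G v" for v by (simp add: H_def)
  have H_pos: "0 < H v" for v using supersolution_pos[OF G] \<gamma>' by (simp add: H_def)
  have H_anti: "antimono H"
    using G' by (auto simp: antimono_def H_def min_le_iff_disj)
  have [measurable]: "H \<in> borel_measurable borel" by (rule antimono_measurable[OF H_anti])
  have int_H: "integrable M (\<lambda>\<omega>. H (v + ?x \<omega>))" for v
    by (rule integrable_const_bound[of _ 1])
       (use H_pos order_trans[OF HG supersolution_le_1[OF G]] in \<open>auto simp: less_imp_le\<close>)
  have le: "(\<integral>\<omega>. H (v + ?x \<omega>) \<partial>M) ^ k \<le> (\<integral>\<omega>. G (v + ?x \<omega>) \<partial>M) ^ k" for v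
    by (intro power_mono integral_mono int_H supersolution_integrable[OF G] HG
        Bochner_Integration.integral_nonneg less_imp_le[OF H_pos])
  have "supersolution a k H q (min \<beta> \<gamma>') (min \<kappa> \<kappa>1)"
    unfolding supersolution_def
  proof (intro conjI allI impI)
    fix v :: real
    have "\<beta> \<le> G v" using G' by simp
    then show "min \<beta> \<gamma>' \<le> H v" by (auto simp: H_def min_def)
    assume v: "0 \<le> v"
    show "H v \<le> q" using G' HG v order_trans by blast
    show "(\<integral>\<omega>. H (v + ?x \<omega>) \<partial>M) ^ k \<le> (1 - min \<kappa> \<kappa>1) * H v"
    proof (cases "v < V' \<or> G v \<le> \<gamma>'")
      case True
      then have "H v = G v" by (auto simp: H_def)
      moreover have "(1 - \<kappa>) * G v \<le> (1 - min \<kappa> \<kappa>1) * G v"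
        using supersolution_pos[OF G, of v] by (intro mult_right_mono) auto
      ultimately show ?thesis using le[of v] G' v by fastforce
    next
      case False
      then have "H v = \<gamma>'" by (auto simp: H_def)
      moreover have "(1 - \<kappa>1) * \<gamma>' \<le> (1 - min \<kappa> \<kappa>1) * \<gamma>'"
        using \<gamma>' by (intro mult_right_mono) auto
      ultimately show ?thesis using le[of v] tail[of v] False by fastforce
    qed
  qed (use H_anti G' \<gamma>' \<kappa>1 V' in \<open>auto simp: H_def\<close>)
  moreover have "H V' \<le> \<gamma>'" by (simp add: H_def)
  ultimately show ?thesis unfolding \<gamma>'_def by blast
qed

text \<open>Each improvement multiplies a level \<open>\<gamma> \<le> q\<close> by at most
  \<open>(1 + q) / 2\<close>, with the original \<open>q\<close>, so the levels decay geometrically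
  although the other parameters change.\<close>

lemma supersolution_small:
  assumes G: "supersolution a k G q \<beta> \<kappa>" and k: "2 \<le> k" and e: "0 < e"
  shows "\<exists>G' q' \<beta>' \<kappa>' V'. supersolution a k G' q' \<beta>' \<kappa>' \<and> G' V' \<le> e"
proof -
  have q: "0 < q" "q < 1" "G 0 \<le> q" using G by (auto simp: supersolution_def)
  let ?\<rho> = "(1 + q) / 2"
  have \<rho>: "0 < ?\<rho>" "?\<rho> < 1" using q by auto
  have ex: "\<exists>G' q' \<beta>' \<kappa>' V'. supersolution a k G' q' \<beta>' \<kappa>' \<and> G' V' \<le> q * ?\<rho> ^ j" for j
  proof (induction j)
    case 0
    then show ?case using G q(3) by auto
  next
    case (Suc j)
    let ?\<gamma> = "q * ?\<rho> ^ j"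
    have "?\<rho> ^ j \<le> 1" using \<rho> by (intro power_le_one) auto
    then have \<gamma>: "0 < ?\<gamma>" "?\<gamma> \<le> q" using q \<rho> by (auto simp: mult_left_le)
    obtain G' q' \<beta>' \<kappa>' V' where "supersolution a k G' q' \<beta>' \<kappa>'" "G' V' \<le> ?\<gamma>" using Suc by blast
    from supersolution_improve[OF this(1) k \<gamma>(1) _ this(2)] \<gamma> q obtain G' q' \<beta>' \<kappa>' V' where
      *: "supersolution a k G' q' \<beta>' \<kappa>'" "G' V' \<le> ?\<gamma> * ((1 + ?\<gamma>) / 2)" by auto
    have "?\<gamma> * ((1 + ?\<gamma>) / 2) \<le> ?\<gamma> * ?\<rho>" using \<gamma> by (intro mult_left_mono) auto
    also have "\<dots> = q * ?\<rho> ^ Suc j" by simp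
    finally show ?case using * order_trans by blast
  qed
  have "(\<lambda>j. q * ?\<rho> ^ j) \<longlonglongrightarrow> q * 0" using \<rho> by (intro tendsto_mult LIMSEQ_power_zero) auto
  then have "eventually (\<lambda>j. q * ?\<rho> ^ j < e) sequentially" using e by (intro order_tendstoD) auto
  then obtain j where "q * ?\<rho> ^ j < e" by (auto simp: eventually_sequentially)
  with ex[of j] show ?thesis by (meson less_imp_le order_trans)
qed

text \<open>As \<open>a\<close> exceeds \<open>a'\<close>, \<open>k * E exp (s (a + L))\<close> is
  at least \<open>exp (s (a - a'))\<close>. For large \<open>s\<close> this is more than
  \<open>k\<close>, so the moment passes 1 and a centring tilt exists; at that tilt, wherever it
  lies, it is still more than 1, which is the growth needed.\<close>

lemma supersolution_of_rate:
  fixes k :: nat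
  assumes neg: "a + (\<integral>\<omega>. L \<omega> \<partial>M) < 0" and a': "a' < a" and e: "0 < e"
    and rate: "\<And>s. 0 \<le> s \<Longrightarrow> exp (- s * a') \<le> real k * (\<integral>\<omega>. exp (s * L \<omega>) \<partial>M)"
  shows "\<exists>G q \<beta> \<kappa> V. supersolution a k G q \<beta> \<kappa> \<and> G V \<le> e"
proof -
  let ?\<psi> = "\<lambda>s. \<integral>\<omega>. exp (s * (a + L \<omega>)) \<partial>M"
  have \<psi>: "?\<psi> s = exp (s * a) * (\<integral>\<omega>. exp (s * L \<omega>) \<partial>M)" for s
    by (simp add: distrib_left exp_add)
  have rate': "exp (s * (a - a')) \<le> real k * ?\<psi> s" if "0 \<le> s" for s
    using mult_left_mono[OF rate[OF that], of "exp (s * a)"]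
    unfolding \<psi> by (simp add: algebra_simps exp_add[symmetric])
  have k: "1 \<le> k" using rate[of 0] by (cases k) auto
  define s where "s = (ln (real k) + 1) / (a - a')"
  have s: "0 < s" using k a' by (simp add: s_def add_nonneg_pos)
  have "real k < exp (ln (real k) + 1)" using k by (simp add: exp_add)
  also have "ln (real k) + 1 = s * (a - a')" using a' by (simp add: s_def)
  also have "exp \<dots> \<le> real k * ?\<psi> s" using s by (intro rate') simp
  finally have large: "1 < ?\<psi> s" using k by simp
  obtain r where r: "0 < r" "(\<integral>\<omega>. (a + L \<omega>) * exp (r * (a + L \<omega>)) \<partial>M) = 0"
    using tilt_exists[OF neg s large] by blast
  have "1 < exp (r * (a - a'))" using r a' by simp
  then have gt: "1 < real k * ?\<psi> r" using rate'[of r] r(1) by linarith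
  \<comment> \<open>At the centring tilt the moment itself is at most 1, so growth must come from
    having several parents.\<close>
  have "2 \<le> k"
  proof (rule ccontr)
    assume "\<not> 2 \<le> k"
    then have "k = 1" using k by simp
    have "?\<psi> r \<le> 1" using expectation_exp_tilt_le[of r a] r by simp
    with gt \<open>k = 1\<close> show False by simp
  qed
  \<comment> \<open>Otherwise \<open>a + L \<le> 0\<close> almost surely, and the moment at
    \<open>s\<close> could not exceed 1.\<close>
  moreover have "\<exists>\<delta>>0. 0 < prob {\<omega>\<in>space M. \<delta> \<le> a + L \<omega>}"
  proof (rule ccontr)
    assume "\<not> ?thesis"
    then have "prob {\<omega>\<in>space M. \<delta> \<le> a + L \<omega>} = 0" if "0 < \<delta>" for \<delta>
      using that zero_less_measure_iff by blast
    then have "AE \<omega> in M. a + L \<omega> < \<delta>" if "0 < \<delta>" for \<delta>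
      using that by (subst AE_iff_measurable[of "{\<omega>\<in>space M. \<delta> \<le> a + L \<omega>}"])
        (auto simp: emeasure_eq_measure not_less)
    then have "AE \<omega> in M. \<forall>n::nat. a + L \<omega> < inverse (real (Suc n))"
      by (simp add: AE_all_countable)
    then have "AE \<omega> in M. exp (s * (a + L \<omega>)) \<le> 1"
    proof eventually_elim
      case (elim \<omega>)
      have "a + L \<omega> \<le> 0"
      proof (rule ccontr)
        assume "\<not> a + L \<omega> \<le> 0"
        then obtain n where "inverse (real (Suc n)) < a + L \<omega>" using reals_Archimedean[of "a + L \<omega>"] by auto
        with elim show False by (meson less_asym)
      qed
      then show ?case using s by (simp add: mult_nonneg_nonpos)
    qed
    then have "?\<psi> s \<le> (\<integral>\<omega>. 1 \<partial>M)" using s by (intro integral_mono_AE integrable_exp_tilt) auto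
    then show False using large by (simp add: prob_space)
  qed
  ultimately show ?thesis
    using supersolution_exists[of r a k] r gt supersolution_small[OF _ _ e] by (metis less_imp_le)
qed

subsection \<open>The rate\<close>

lemma log_mgf_eq:
  assumes "integrable M (\<lambda>\<omega>. exp (l * L \<omega>))"
  shows "log_mgf M (\<lambda>\<omega>. - L \<omega>) (- l) = ereal (ln (\<integral>\<omega>. exp (l * L \<omega>) \<partial>M))"
proof -
  have "(\<integral>\<^sup>+\<omega>. ennreal (exp (l * L \<omega>)) \<partial>M) = ennreal (\<integral>\<omega>. exp (l * L \<omega>) \<partial>M)"
    by (rule nn_integral_eq_integral[OF assms]) simp
  then show ?thesis by (simp add: log_mgf_def Let_def enn2real_ennreal)
qed

lemma log_mgf_not_integrable:
  assumes "\<not> integrable M (\<lambda>\<omega>. exp (l * L \<omega>))"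
  shows "log_mgf M (\<lambda>\<omega>. - L \<omega>) (- l) = \<infinity>"
proof -
  have "(\<integral>\<^sup>+\<omega>. ennreal (exp (l * L \<omega>)) \<partial>M) = \<infinity>"
  proof (rule ccontr)
    assume "\<not> ?thesis"
    then have "(\<integral>\<^sup>+\<omega>. ennreal (exp (l * L \<omega>)) \<partial>M) < \<infinity>" by (simp add: less_top)
    then have "integrable M (\<lambda>\<omega>. exp (l * L \<omega>))" by (intro integrableI_nonneg) auto
    with assms show False ..
  qed
  then show ?thesis by (simp add: log_mgf_def)
qed

text \<open>An infinite \<open>log_mgf\<close> contributes \<open>- \<infinity>\<close> to the
  supremum, so only integrable exponents impose a condition. The sign of the exponent is flipped in
  order to work with \<open>L\<close>.\<close>

lemma log_mgf_dual_le_iff: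
  "log_mgf_dual M (\<lambda>\<omega>. - L \<omega>) y \<le> ereal b \<longleftrightarrow>
    (\<forall>l. integrable M (\<lambda>\<omega>. exp (l * L \<omega>)) \<longrightarrow> - l * y - ln (\<integral>\<omega>. exp (l * L \<omega>) \<partial>M) \<le> b)"
proof -
  have "log_mgf_dual M (\<lambda>\<omega>. - L \<omega>) y \<le> ereal b \<longleftrightarrow>
      (\<forall>l. ereal (l * y) - log_mgf M (\<lambda>\<omega>. - L \<omega>) l \<le> ereal b)"
    unfolding log_mgf_dual_def by (simp add: SUP_le_iff)
  also have "\<dots> \<longleftrightarrow> (\<forall>l. ereal (- l * y) - log_mgf M (\<lambda>\<omega>. - L \<omega>) (- l) \<le> ereal b)"
    by (metis minus_minus)
  also have "\<dots> \<longleftrightarrow>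
    (\<forall>l. integrable M (\<lambda>\<omega>. exp (l * L \<omega>)) \<longrightarrow> - l * y - ln (\<integral>\<omega>. exp (l * L \<omega>) \<partial>M) \<le> b)"
  proof (intro all_cong1)
    fix l
    show "ereal (- l * y) - log_mgf M (\<lambda>\<omega>. - L \<omega>) (- l) \<le> ereal b \<longleftrightarrow>
      (integrable M (\<lambda>\<omega>. exp (l * L \<omega>)) \<longrightarrow> - l * y - ln (\<integral>\<omega>. exp (l * L \<omega>) \<partial>M) \<le> b)"
      by (cases "integrable M (\<lambda>\<omega>. exp (l * L \<omega>))") (simp_all add: log_mgf_eq log_mgf_not_integrable)
  qed
  finally show ?thesis .
qed

definition rate_set :: "nat \<Rightarrow> real set" where
  "rate_set k = {z. 1 / (\<integral>\<omega>. - L \<omega> \<partial>M) \<le> z \<and> log_mgf_dual M (\<lambda>\<omega>. - L \<omega>) (1 / z) \<le> ereal (ln (real k))}"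

lemma sarrd_rate_eq: "sarrd_rate M k X = Sup (rate_set k)"
  by (simp add: sarrd_rate_def rate_set_def Let_def)

lemma mean_pos: "0 < (\<integral>\<omega>. - L \<omega> \<partial>M)"
  using expectation_L_neg by simp

lemma jensen_ln:
  assumes "integrable M (\<lambda>\<omega>. exp (l * L \<omega>))"
  shows "l * (\<integral>\<omega>. L \<omega> \<partial>M) \<le> ln (\<integral>\<omega>. exp (l * L \<omega>) \<partial>M)"
  using jensen_exp[OF assms] expectation_exp_pos[OF assms] by (simp add: ln_ge_iff)

text \<open>By Jensen every finite term of the supremum is at most 0, and \<open>ln k\<close> is
  nonnegative.\<close>

lemma mean_in_rate_set:
  assumes "1 \<le> k"
  shows "1 / (\<integral>\<omega>. - L \<omega> \<partial>M) \<in> rate_set k"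
proof -
  have "- l * (\<integral>\<omega>. - L \<omega> \<partial>M) - ln (\<integral>\<omega>. exp (l * L \<omega>) \<partial>M) \<le> ln (real k)"
    if "integrable M (\<lambda>\<omega>. exp (l * L \<omega>))" for l
  proof -
    have "- l * (\<integral>\<omega>. - L \<omega> \<partial>M) = l * (\<integral>\<omega>. L \<omega> \<partial>M)" by simp
    moreover have "0 \<le> ln (real k)" using assms by simp
    ultimately show ?thesis using jensen_ln[OF that] by linarith
  qed
  then show ?thesis unfolding rate_set_def using log_mgf_dual_le_iff by simp
qed

lemma rate_set_exp_le:
  assumes z: "z \<in> rate_set k" and k: "1 \<le> k" and s: "0 \<le> s"
  shows "exp (- s * (1 / z)) \<le> real k * (\<integral>\<omega>. exp (s * L \<omega>) \<partial>M)"
proof -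
  have int: "integrable M (\<lambda>\<omega>. exp (s * L \<omega>))" using s by (intro integrable_exp_L) simp
  have pos: "0 < (\<integral>\<omega>. exp (s * L \<omega>) \<partial>M)" by (rule expectation_exp_pos[OF int])
  have "- s * (1 / z) - ln (\<integral>\<omega>. exp (s * L \<omega>) \<partial>M) \<le> ln (real k)"
    using z int unfolding rate_set_def log_mgf_dual_le_iff by blast
  then have "- s * (1 / z) \<le> ln (real k * (\<integral>\<omega>. exp (s * L \<omega>) \<partial>M))"
    using k pos by (simp add: ln_mult)
  then show ?thesis using k pos by (simp add: ln_ge_iff)
qed

lemma rate_set_pos: "z \<in> rate_set k \<Longrightarrow> 0 < z"
  using mean_pos unfolding rate_set_def by (smt (verit) mem_Collect_eq zero_less_divide_1_iff)

lemma expectation_exp_tendsto_0: "(\<lambda>n. \<integral>\<omega>. exp (real n * L \<omega>) \<partial>M) \<longlonglongrightarrow> 0"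
proof -
  have "(\<lambda>n. \<integral>\<omega>. exp (real n * L \<omega>) \<partial>M) \<longlonglongrightarrow> (\<integral>\<omega>. 0 \<partial>M)"
  proof (rule integral_dominated_convergence[where w="\<lambda>_. 1"])
    show "AE \<omega> in M. (\<lambda>n. exp (real n * L \<omega>)) \<longlonglongrightarrow> 0"
      using L_neg
    proof eventually_elim
      case (elim \<omega>)
      have "(\<lambda>n. exp (L \<omega>) ^ n) \<longlonglongrightarrow> 0" using elim by (intro LIMSEQ_power_zero) simp
      then show ?case by (simp add: exp_of_nat_mult)
    qed
    show "AE \<omega> in M. norm (exp (real n * L \<omega>)) \<le> 1" for n
      using L_neg by eventually_elim (simp add: mult_nonneg_nonpos)
  qed auto
  then show ?thesis by simp
qed

text \<open>Membership tested at the exponent \<open>n\<close> reads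
  \<open>exp (- n / z) \<le> k * E X ^ n\<close>. Since \<open>E X ^ n\<close> tends to 0, some
  \<open>n\<close> brings the right side below \<open>exp (- 1)\<close>, and then
  \<open>z < n\<close>.\<close>

lemma rate_set_bdd:
  assumes k: "1 \<le> k"
  shows "bdd_above (rate_set k)"
proof -
  have "eventually (\<lambda>n. (\<integral>\<omega>. exp (real n * L \<omega>) \<partial>M) < exp (- 1) / real k) sequentially"
    by (rule order_tendstoD(2)[OF expectation_exp_tendsto_0]) (use k in simp)
  then obtain n where n: "(\<integral>\<omega>. exp (real n * L \<omega>) \<partial>M) < exp (- 1) / real k"
    by (auto simp: eventually_sequentially)
  have "z \<le> real n" if z: "z \<in> rate_set k" for z
  proof -
    have "exp (- real n * (1 / z)) \<le> real k * (\<integral>\<omega>. exp (real n * L \<omega>) \<partial>M)"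
      by (rule rate_set_exp_le[OF z k]) simp
    also have "\<dots> < exp (- 1)" using n k by (simp add: field_simps)
    finally show ?thesis using rate_set_pos[OF z] by (simp add: field_simps)
  qed
  then show ?thesis by (auto simp: bdd_above_def)
qed

lemma sarrd_rate_ge: "1 \<le> k \<Longrightarrow> 1 / (\<integral>\<omega>. - L \<omega> \<partial>M) \<le> sarrd_rate M k X"
  unfolding sarrd_rate_eq by (intro cSup_upper mean_in_rate_set rate_set_bdd)

text \<open>Some exponent violates the defining inequality. It is positive, because for nonpositive
  exponents Jensen and \<open>1 / z \<le> E (- L)\<close> yield that inequality. The conclusion is
  what makes \<open>n powr s * (k * E exp (s L)) ^ t\<close> vanish for \<open>t\<close> near
  \<open>z * ln n\<close>.\<close>

lemma above_rate:
  assumes k: "1 \<le> k" and z: "sarrd_rate M k X < z"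
  obtains s where "0 < s" "s + z * ln (real k * (\<integral>\<omega>. exp (s * L \<omega>) \<partial>M)) < 0"
proof -
  let ?m = "\<integral>\<omega>. L \<omega> \<partial>M"
  have z1: "1 / (\<integral>\<omega>. - L \<omega> \<partial>M) \<le> z" using sarrd_rate_ge[OF k] z by linarith
  have z0: "0 < z" using z1 mean_pos less_le_trans zero_less_divide_1_iff by blast
  have "z \<notin> rate_set k" using cSup_upper[OF _ rate_set_bdd[OF k]] z unfolding sarrd_rate_eq by fastforce
  then obtain l where l: "integrable M (\<lambda>\<omega>. exp (l * L \<omega>))"
    "ln (real k) < - l * (1 / z) - ln (\<integral>\<omega>. exp (l * L \<omega>) \<partial>M)"
    using z1 unfolding rate_set_def log_mgf_dual_le_iff by (auto simp: not_le)
  have "0 < l"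
  proof (rule ccontr)
    assume "\<not> 0 < l"
    then have "0 \<le> - l * (- ?m - 1 / z)"
      using z1 z0 mean_pos by (intro mult_nonneg_nonneg) (auto simp: field_simps)
    then have "- l * (1 / z) - ln (\<integral>\<omega>. exp (l * L \<omega>) \<partial>M) \<le> 0"
      using jensen_ln[OF l(1)] by (simp add: algebra_simps)
    moreover have "0 \<le> ln (real k)" using k by simp
    ultimately show False using l(2) by linarith
  qed
  moreover have "l + z * ln (real k * (\<integral>\<omega>. exp (l * L \<omega>) \<partial>M)) < 0"
    using l(2) z0 k expectation_exp_pos[OF l(1)] by (simp add: ln_mult field_simps)
  ultimately show ?thesis using that by blast
qed

lemma below_rate:
  assumes k: "1 \<le> k" and z: "z < sarrd_rate M k X"
  obtains z' where "z < z'" "0 < z'" "\<And>s. 0 \<le> s \<Longrightarrow> exp (- s * (1 / z')) \<le> real k * (\<integral>\<omega>. exp (s * L \<omega>) \<partial>M)"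
proof -
  obtain z' where "z' \<in> rate_set k" "z < z'"
    using z less_cSup_iff[OF _ rate_set_bdd[OF k]] mean_in_rate_set[OF k] unfolding sarrd_rate_eq by blast
  then show ?thesis using that rate_set_exp_le[OF _ k] rate_set_pos by blast
qed

text \<open>The exponential moment of \<open>- L\<close> is \<open>1 + s E (- L) + O (s\<^sup>2)\<close>.\<close>

lemma below_mean:
  assumes z: "0 < z" "z < 1 / (\<integral>\<omega>. - L \<omega> \<partial>M)"
  obtains s where "0 < s" "s \<le> 1 / 4" "z * ln (\<integral>\<omega>. exp (- s * L \<omega>) \<partial>M) < s"
proof -
  let ?m = "\<integral>\<omega>. - L \<omega> \<partial>M"
  \<comment> \<open>For \<open>y = - L\<close> the second-order remainder is at most
    \<open>exp (y / 4) * (s * y) ^ 2 / 2\<close>, and \<open>y ^ 2 \<le> 32 * exp (y / 4)\<close>;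
    hence the factor 16 and the exponent \<open>y / 2\<close>, whose integrability is known.\<close>
  define K where "K = (\<integral>\<omega>. 16 * exp (- L \<omega> / 2) \<partial>M)"
  have K: "0 \<le> K" unfolding K_def by (intro Bochner_Integration.integral_nonneg) simp
  have int_K: "integrable M (\<lambda>\<omega>. 16 * exp (- L \<omega> / 2))" using integrable_exp_half by simp
  have bound: "(\<integral>\<omega>. exp (- s * L \<omega>) \<partial>M) \<le> 1 + s * ?m + s\<^sup>2 * K" if s: "0 \<le> s" "s \<le> 1 / 4" for s
  proof -
    have "(\<integral>\<omega>. exp (- s * L \<omega>) \<partial>M) \<le> (\<integral>\<omega>. 1 + s * (- L \<omega>) + s\<^sup>2 * (16 * exp (- L \<omega> / 2)) \<partial>M)"
    proof (rule integral_mono_AE)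
      show "integrable M (\<lambda>\<omega>. exp (- s * L \<omega>))" using s by (intro integrable_exp_L) simp
      show "integrable M (\<lambda>\<omega>. 1 + s * (- L \<omega>) + s\<^sup>2 * (16 * exp (- L \<omega> / 2)))"
        using integrable_L int_K by (intro Bochner_Integration.integrable_add integrable_mult_right) auto
      show "AE \<omega> in M. exp (- s * L \<omega>) \<le> 1 + s * (- L \<omega>) + s\<^sup>2 * (16 * exp (- L \<omega> / 2))"
        using L_neg
      proof eventually_elim
        case (elim \<omega>)
        define y where "y = - L \<omega>"
        have y: "0 < y" using elim by (simp add: y_def)
        obtain t where t: "\<bar>t\<bar> \<le> \<bar>s * y\<bar>" "exp (s * y) = (\<Sum>i<2. (s * y) ^ i / fact i) + exp t / fact 2 * (s * y) ^ 2"
          using Maclaurin_exp_le[of "s * y" 2] by blast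
        have "exp (s * y) = 1 + s * y + exp t / 2 * (s * y)\<^sup>2" using t(2) by (simp add: numeral_2_eq_2)
        also have "\<dots> \<le> 1 + s * y + exp (y / 4) / 2 * (s * y)\<^sup>2"
        proof -
          have "s * y \<le> 1 / 4 * y" using s y by (intro mult_right_mono) auto
          moreover have "t \<le> s * y" using t(1) s y by (simp add: abs_le_iff)
          ultimately have "t \<le> y / 4" by linarith
          then show ?thesis by (intro add_left_mono mult_right_mono) auto
        qed
        also have "\<dots> \<le> 1 + s * y + s\<^sup>2 * (16 * exp (y / 2))"
        proof -
          have "1 + y / 4 + (y / 4)\<^sup>2 / 2 \<le> exp (y / 4)"
            by (rule exp_lower_Taylor_quadratic) (use y in simp)
          then have "y\<^sup>2 / 32 \<le> exp (y / 4)" using y by (simp add: power2_eq_square)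
          then have "exp (y / 4) * y\<^sup>2 \<le> exp (y / 4) * (32 * exp (y / 4))"
            by (intro mult_left_mono) auto
          also have "\<dots> = 32 * exp (y / 2)" by (simp add: exp_add[symmetric])
          finally have "s\<^sup>2 * (exp (y / 4) * y\<^sup>2) \<le> s\<^sup>2 * (32 * exp (y / 2))"
            by (intro mult_left_mono) auto
          then show ?thesis by (simp add: power_mult_distrib algebra_simps)
        qed
        finally show ?case by (simp add: y_def)
      qed
    qed
    also have "\<dots> = 1 + s * ?m + s\<^sup>2 * K"
      using integrable_L int_K by (simp add: K_def prob_space)
    finally show ?thesis .
  qed
  define d where "d = 1 / z - ?m"
  have d: "0 < d"
  proof -
    have "z * ?m < 1" using z mean_pos by (simp add: field_simps)
    then show ?thesis using z(1) by (simp add: d_def field_simps)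
  qed
  \<comment> \<open>Small enough that the second-order error \<open>s * K\<close> stays below the
    gap \<open>d\<close> between \<open>1 / z\<close> and the mean.\<close>
  define s where "s = min (1 / 4) (d / (2 * (K + 1)))"
  have s: "0 < s" "s \<le> 1 / 4" using d K by (simp add: s_def) (unfold s_def, rule min.cobounded1)
  have "s \<le> d / (2 * (K + 1))" unfolding s_def by (rule min.cobounded2)
  then have "s * (2 * (K + 1)) \<le> d" using K by (simp add: pos_le_divide_eq)
  then have "2 * s + 2 * (s * K) \<le> d" by (simp add: algebra_simps)
  moreover have "0 \<le> s * K" using s(1) K by simp
  ultimately have sK: "s * K < d" using s(1) by linarith
  have int: "integrable M (\<lambda>\<omega>. exp (- s * L \<omega>))" using s by (intro integrable_exp_L) simp
  have "ln (\<integral>\<omega>. exp (- s * L \<omega>) \<partial>M) \<le> (\<integral>\<omega>. exp (- s * L \<omega>) \<partial>M) - 1"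
    by (rule ln_le_minus_one[OF expectation_exp_pos[OF int]])
  also have "\<dots> \<le> s * (?m + s * K)" using bound[of s] s by (simp add: algebra_simps power2_eq_square)
  also have "\<dots> < s * (1 / z)" using sK s(1) by (intro mult_strict_left_mono) (simp_all add: d_def)
  finally have "z * ln (\<integral>\<omega>. exp (- s * L \<omega>) \<partial>M) < s" using z(1) by (simp add: field_simps)
  with s show ?thesis by (intro that)
qed

end

subsection \<open>Depth bounds\<close>

text \<open>The truncation at \<open>x - 1\<close> acts only off the almost sure event \<open>u \<in> (0,1)\<close>.\<close>

definition parent :: "nat \<Rightarrow> real \<Rightarrow> nat" where
  "parent x u = min (x - 1) (nat \<lfloor>real x * u\<rfloor>)"

lemma parent_measurable [measurable]: "parent x \<in> measurable borel (count_space UNIV)"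
  unfolding parent_def by measurable

lemma parent_eq:
  assumes "0 < u" "u < 1"
  shows "parent x u = nat \<lfloor>real x * u\<rfloor>"
  using parent_less[of x u] assms by (cases "x = 0") (auto simp: parent_def)

lemma real_parent:
  assumes "0 < u" "u < 1"
  shows "real (parent x u) \<le> real x * u" "real x * u < real (parent x u) + 1"
proof -
  have "0 \<le> real x * u" using assms by simp
  then show "real (parent x u) \<le> real x * u" "real x * u < real (parent x u) + 1"
    unfolding parent_eq[OF assms] by (simp_all add: of_nat_nat)
qed

locale sarrd = bounded_density_attachment M X f C for M :: "'a measure" and X f C +
  fixes k :: nat and U :: "nat \<Rightarrow> nat \<Rightarrow> 'a \<Rightarrow> real"
  assumes k1: "1 \<le> k" and attach: "sarrd_attachment M k X U"
begin

definition Z :: "nat \<times> nat \<Rightarrow> 'a \<Rightarrow> nat" where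
  "Z = (\<lambda>(x, p) \<omega>. parent x (U x p \<omega>))"

lemma U_indep: "indep_vars (\<lambda>_. borel) (\<lambda>(x, p). U x p) (UNIV \<times> {1..k})"
  using attach by (simp add: sarrd_attachment_def)

lemma U_measurable: "p \<in> {1..k} \<Longrightarrow> U x p \<in> borel_measurable M"
  using U_indep by (force simp: indep_vars_def)

lemma U_distr: "p \<in> {1..k} \<Longrightarrow> distr M borel (U x p) = distr M borel X"
  using attach by (simp add: sarrd_attachment_def)

sublocale random_parents M k Z
proof
  have "indep_vars (\<lambda>_. count_space UNIV) (\<lambda>i \<omega>. parent (fst i) ((\<lambda>(x, p). U x p) i \<omega>)) (UNIV \<times> {1..k})"
    by (rule indep_vars_compose2[OF U_indep]) simp
  moreover have "Z = (\<lambda>i \<omega>. parent (fst i) ((\<lambda>(x, p). U x p) i \<omega>))"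
    by (auto simp: Z_def fun_eq_iff)
  ultimately show "indep_vars (\<lambda>_. count_space UNIV) Z (UNIV \<times> {1..k})" by simp
qed (use k1 in \<open>auto simp: Z_def parent_def\<close>)

section \<open>From the attachment variables to the law of one parent\<close>

lemma expectation_Z:
  fixes g :: "nat \<Rightarrow> real"
  assumes p: "p \<in> {1..k}"
  shows "(\<integral>\<omega>. g (Z (x, p) \<omega>) \<partial>M) = (\<integral>\<omega>. g (parent x (X \<omega>)) \<partial>M)"
proof -
  have "(\<integral>\<omega>. g (parent x (U x p \<omega>)) \<partial>M) = (\<integral>u. g (parent x u) \<partial>distr M borel (U x p))"
    using U_measurable[OF p] by (intro integral_distr[symmetric]) auto
  also have "\<dots> = (\<integral>\<omega>. g (parent x (X \<omega>)) \<partial>M)"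
    unfolding U_distr[OF p] by (intro integral_distr) auto
  finally show ?thesis by (simp add: Z_def)
qed

lemma integrable_parent:
  fixes g :: "nat \<Rightarrow> real"
  shows "integrable M (\<lambda>\<omega>. g (parent x (X \<omega>)))"
proof (rule integrable_const_bound)
  show "AE \<omega> in M. norm (g (parent x (X \<omega>))) \<le> (\<Sum>y\<le>x. \<bar>g y\<bar>)"
    by (intro AE_I2 order_trans[OF _ member_le_sum[of "parent x (X _)" "{..x}" "\<lambda>y. \<bar>g y\<bar>"]])
       (auto simp: parent_def)
qed measurable

lemma U_AE: "AE \<omega> in M. \<forall>x. \<forall>p\<in>{1..k}. 0 < U x p \<omega> \<and> U x p \<omega> < 1"
proof -
  have "AE \<omega> in M. 0 < U x p \<omega> \<and> U x p \<omega> < 1" if p: "p \<in> {1..k}" for x p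
  proof -
    have "AE u in distr M borel X. 0 < u \<and> u < 1" using X_AE by (simp add: AE_distr_iff)
    then have "AE u in distr M borel (U x p). 0 < u \<and> u < 1" unfolding U_distr[OF p] .
    then show ?thesis using U_measurable[OF p] by (simp add: AE_distr_iff)
  qed
  then show ?thesis by (simp add: AE_all_countable AE_ball_countable)
qed

text \<open>One null set contains all failures of \<open>0 < U x p < 1\<close>; outside it the
  truncated parents are the true ones, so the equivalence holds for all \<open>n\<close> and
  \<open>t\<close> at once.\<close>

lemma depth_less_AE:
  "AE \<omega> in M. \<forall>n t. sarrd_depth k (\<lambda>x p. U x p \<omega>) n < t \<longleftrightarrow> sh t n \<omega>"
  using U_AE
proof eventually_elim
  case (elim \<omega>)
  have "sh t n \<omega> \<longleftrightarrow> shallow k (\<lambda>(x, p). nat \<lfloor>real x * U x p \<omega>\<rfloor>) t n" for n t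
    unfolding sh_def
    by (rule shallow_cong[of "Suc n"]) (use elim in \<open>auto simp: Z_def parent_eq intro!: parent_less\<close>)
  moreover have "sarrd_depth k (\<lambda>x p. U x p \<omega>) n < t \<longleftrightarrow>
      shallow k (\<lambda>(x, p). nat \<lfloor>real x * U x p \<omega>\<rfloor>) t n" for n t
    using elim by (intro sarrd_depth_less_iff k1) auto
  ultimately show ?case by simp
qed

text \<open>A given parent confines \<open>X\<close> to an interval of length \<open>1 / x\<close>.
  This is the collision bound required by \<open>prob_all_sh_le\<close>.\<close>

lemma prob_Z_eq_le:
  assumes p: "p \<in> {1..k}" and x: "0 < x"
  shows "prob {\<omega>\<in>space M. Z (x, p) \<omega> = y} \<le> C / real x"
proof -
  have "prob {\<omega>\<in>space M. Z (x, p) \<omega> = y} = (\<integral>\<omega>. indicat_real {y} (Z (x, p) \<omega>) \<partial>M)"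
  proof -
    have "(\<integral>\<omega>. indicat_real {y} (Z (x, p) \<omega>) \<partial>M) = (\<integral>\<omega>. indicat_real {\<omega>\<in>space M. Z (x, p) \<omega> = y} \<omega> \<partial>M)"
      by (intro Bochner_Integration.integral_cong) (auto split: split_indicator)
    then show ?thesis by (simp add: Int_absorb2)
  qed
  also have "\<dots> = (\<integral>\<omega>. indicat_real {y} (parent x (X \<omega>)) \<partial>M)" by (rule expectation_Z[OF p])
  also have "\<dots> \<le> (\<integral>\<omega>. indicat_real {\<omega>\<in>space M. real y / real x \<le> X \<omega> \<and> X \<omega> \<le> (real y + 1) / real x} \<omega> \<partial>M)"
  proof (rule integral_mono_AE)
    show "AE \<omega> in M. indicat_real {y} (parent x (X \<omega>))
        \<le> indicat_real {\<omega>\<in>space M. real y / real x \<le> X \<omega> \<and> X \<omega> \<le> (real y + 1) / real x} \<omega>"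
      using X_AE AE_space
    proof eventually_elim
      case (elim \<omega>)
      then have "real y / real x \<le> X \<omega> \<and> X \<omega> \<le> (real y + 1) / real x" if "parent x (X \<omega>) = y"
        using real_parent[of "X \<omega>" x] that x by (simp add: field_simps)
      then show ?case using elim by (auto split: split_indicator)
    qed
    show "integrable M (indicat_real {\<omega>\<in>space M. real y / real x \<le> X \<omega> \<and> X \<omega> \<le> (real y + 1) / real x})"
      by (rule integrable_real_indicator) (simp_all add: emeasure_eq_measure)
  qed (rule integrable_parent)
  also have "\<dots> = prob {\<omega>\<in>space M. real y / real x \<le> X \<omega> \<and> X \<omega> \<le> (real y + 1) / real x}"
    by (simp add: Int_absorb2)
  also have "\<dots> \<le> C * ((real y + 1) / real x - real y / real x)"
    by (rule prob_interval_le) (simp add: divide_right_mono)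
  also have "\<dots> = C / real x" using x by (simp add: field_simps)
  finally show ?thesis .
qed

text \<open>Without rounding, the right side solves the recursion of the union bound exactly; for
  \<open>s \<ge> 0\<close> rounding parents down only lowers it.\<close>

lemma prob_deep_le:
  assumes s: "0 \<le> s"
  shows "prob {\<omega>\<in>space M. \<not> sh (Suc t) n \<omega>} \<le> real n powr s * (real k * (\<integral>\<omega>. exp (s * L \<omega>) \<partial>M)) ^ t"
proof (rule prob_not_sh_le)
  let ?\<rho> = "real k * (\<integral>\<omega>. exp (s * L \<omega>) \<partial>M)"
  have \<rho>: "0 \<le> ?\<rho>" by (intro mult_nonneg_nonneg Bochner_Integration.integral_nonneg) auto
  show "0 \<le> real x powr s * ?\<rho> ^ t" for t x using \<rho> by simp
  show "1 \<le> real x powr s * ?\<rho> ^ 0" if "0 < x" for x using that s by (simp add: ge_one_powr_ge_zero)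
  fix t x :: nat assume x: "0 < x"
  have "(\<integral>\<omega>. real (parent x (X \<omega>)) powr s \<partial>M) \<le> (\<integral>\<omega>. real x powr s * exp (s * L \<omega>) \<partial>M)"
  proof (rule integral_mono_AE[OF integrable_parent])
    show "integrable M (\<lambda>\<omega>. real x powr s * exp (s * L \<omega>))"
      using integrable_exp_L[of s] s by simp
    show "AE \<omega> in M. real (parent x (X \<omega>)) powr s \<le> real x powr s * exp (s * L \<omega>)"
      using X_AE
    proof eventually_elim
      case (elim \<omega>)
      have "real (parent x (X \<omega>)) powr s \<le> (real x * X \<omega>) powr s"
        using real_parent[of "X \<omega>" x] elim s by (intro powr_mono2) auto
      also have "\<dots> = real x powr s * exp (s * L \<omega>)"
        using elim by (simp add: powr_mult) (simp add: powr_def)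
      finally show ?case .
    qed
  qed
  then have "?\<rho> ^ t * (\<integral>\<omega>. real (parent x (X \<omega>)) powr s \<partial>M) \<le> ?\<rho> ^ t * (real x powr s * (\<integral>\<omega>. exp (s * L \<omega>) \<partial>M))"
    using \<rho> by (intro mult_left_mono) auto
  then have *: "(\<integral>\<omega>. real (parent x (X \<omega>)) powr s * ?\<rho> ^ t \<partial>M) \<le> ?\<rho> ^ t * (real x powr s * (\<integral>\<omega>. exp (s * L \<omega>) \<partial>M))"
    by (simp add: mult.commute)
  have "(\<Sum>p\<in>{1..k}. \<integral>\<omega>. real (Z (x, p) \<omega>) powr s * ?\<rho> ^ t \<partial>M)
      = (\<Sum>p\<in>{1..k}. \<integral>\<omega>. real (parent x (X \<omega>)) powr s * ?\<rho> ^ t \<partial>M)"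
    by (intro sum.cong refl expectation_Z)
  also have "\<dots> = real k * (\<integral>\<omega>. real (parent x (X \<omega>)) powr s * ?\<rho> ^ t \<partial>M)" by simp
  also have "\<dots> \<le> real k * (?\<rho> ^ t * (real x powr s * (\<integral>\<omega>. exp (s * L \<omega>) \<partial>M)))"
    by (intro mult_left_mono *) simp
  also have "\<dots> = real x powr s * ?\<rho> ^ Suc t" by simp
  finally show "(\<Sum>p\<in>{1..k}. \<integral>\<omega>. real (Z (x, p) \<omega>) powr s * ?\<rho> ^ t \<partial>M) \<le> real x powr s * ?\<rho> ^ Suc t" .
qed

text \<open>With a negative exponent rounding down hurts. The shift to \<open>x + 1\<close> absorbs
  it, at the price of a factor \<open>(1 + 1 / B) powr s\<close> per step as long as
  \<open>x \<ge> B\<close>. Below \<open>B\<close> the prefactor makes the bound at least 1, and the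
  truncation at 1 closes the recursion.\<close>

lemma prob_shallow_le:
  fixes B :: real
  assumes s: "0 \<le> s" "s \<le> 1 / 2" and B: "0 < B"
  shows "prob {\<omega>\<in>space M. sh t n \<omega>} \<le> (B + 1) powr s * (real n + 1) powr (- s) *
    ((1 + 1 / B) powr s * (\<integral>\<omega>. exp (- s * L \<omega>) \<partial>M)) ^ t"
proof -
  let ?m = "\<integral>\<omega>. exp (- s * L \<omega>) \<partial>M"
  let ?\<rho> = "(1 + 1 / B) powr s * ?m" and ?K = "(B + 1) powr s"
  define h where "h t x = ?K * (real x + 1) powr (- s) * ?\<rho> ^ t" for t x :: nat
  have int: "integrable M (\<lambda>\<omega>. exp (- s * L \<omega>))" using s by (intro integrable_exp_L) simp
  have "(\<integral>\<omega>. 1 \<partial>M) \<le> ?m"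
    using L_neg s by (intro integral_mono_AE int) (auto elim!: eventually_mono simp: mult_nonneg_nonpos)
  then have m1: "1 \<le> ?m" by (simp add: prob_space)
  have "1 * 1 \<le> ?\<rho>" using m1 s B by (intro mult_mono) (auto simp: ge_one_powr_ge_zero)
  then have \<rho>: "1 \<le> ?\<rho>" by simp
  have K: "1 \<le> ?K" using s B by (simp add: ge_one_powr_ge_zero)
  have h0: "0 \<le> h t x" for t x using \<rho> by (simp add: h_def)
  have "prob {\<omega>\<in>space M. sh t n \<omega>} \<le> min 1 (h t n)"
  proof (rule prob_sh_le)
    show "1 \<le> min 1 (h (Suc t) 0)" for t
    proof -
      have "1 * 1 \<le> ?K * ?\<rho> ^ Suc t" using K \<rho> by (intro mult_mono one_le_power) auto
      then show ?thesis by (simp add: h_def)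
    qed
    show "0 \<le> min 1 (h 0 x)" for x using h0 by simp
    fix t x :: nat assume x: "0 < x"
    have E: "(\<integral>\<omega>. min 1 (h t (Z (x, 1) \<omega>)) \<partial>M) = (\<integral>\<omega>. min 1 (h t (parent x (X \<omega>))) \<partial>M)"
      using k1 by (intro expectation_Z[of 1 "\<lambda>y. min 1 (h t y)"]) simp
    have "(\<integral>\<omega>. min 1 (h t (parent x (X \<omega>))) \<partial>M) \<le> (\<integral>\<omega>. 1 \<partial>M)"
      by (intro integral_mono integrable_parent) auto
    then have 1: "(\<integral>\<omega>. min 1 (h t (parent x (X \<omega>))) \<partial>M) \<le> 1" by (simp add: prob_space)
    have 2: "(\<integral>\<omega>. min 1 (h t (parent x (X \<omega>))) \<partial>M) \<le> h (Suc t) x"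
    proof (cases "real x < B")
      case True
      have "1 * 1 \<le> ((B + 1) / (real x + 1)) powr s * ?\<rho> ^ Suc t"
        using True s \<rho> by (intro mult_mono one_le_power ge_one_powr_ge_zero) auto
      also have "\<dots> = h (Suc t) x"
        using B by (simp add: h_def powr_divide powr_minus field_simps)
      finally show ?thesis using 1 by simp
    next
      case False
      have "(\<integral>\<omega>. min 1 (h t (parent x (X \<omega>))) \<partial>M)
          \<le> (\<integral>\<omega>. ?K * ?\<rho> ^ t * ((1 + 1 / B) powr s * (real x + 1) powr (- s)) * exp (- s * L \<omega>) \<partial>M)"
      proof (rule integral_mono_AE[OF integrable_parent])
        show "AE \<omega> in M. min 1 (h t (parent x (X \<omega>)))
            \<le> ?K * ?\<rho> ^ t * ((1 + 1 / B) powr s * (real x + 1) powr (- s)) * exp (- s * L \<omega>)"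
          using X_AE
        proof eventually_elim
          case (elim \<omega>)
          have "real x + 1 \<le> (1 + 1 / B) * real x" using False B by (simp add: field_simps)
          then have "(real x + 1) powr s \<le> ((1 + 1 / B) * real x) powr s" using s by (intro powr_mono2) auto
          then have "(real x + 1) powr s \<le> (1 + 1 / B) powr s * real x powr s" using B by (simp add: powr_mult)
          then have x': "real x powr (- s) \<le> (1 + 1 / B) powr s * (real x + 1) powr (- s)"
            using x by (simp add: powr_minus field_simps)
          have "(real (parent x (X \<omega>)) + 1) powr (- s) \<le> (real x * X \<omega>) powr (- s)"
            using real_parent[of "X \<omega>" x] elim s x by (intro powr_mono2') auto
          also have "\<dots> = real x powr (- s) * exp (- s * L \<omega>)"
            using elim x by (simp add: powr_mult) (simp add: powr_def)
          also have "\<dots> \<le> (1 + 1 / B) powr s * (real x + 1) powr (- s) * exp (- s * L \<omega>)"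
            by (intro mult_right_mono x') simp
          finally have "?K * ?\<rho> ^ t * (real (parent x (X \<omega>)) + 1) powr (- s)
              \<le> ?K * ?\<rho> ^ t * ((1 + 1 / B) powr s * (real x + 1) powr (- s) * exp (- s * L \<omega>))"
            using \<rho> by (intro mult_left_mono) auto
          then show ?case by (simp add: h_def mult_ac min.coboundedI2)
        qed
      qed (use int in simp)
      also have "\<dots> = h (Suc t) x" by (simp add: h_def mult_ac)
      finally show ?thesis .
    qed
    show "(\<integral>\<omega>. min 1 (h t (Z (x, 1) \<omega>)) \<partial>M) \<le> min 1 (h (Suc t) x)"
      unfolding E using 1 2 by simp
  qed
  then show ?thesis by (simp add: h_def)
qed

text \<open>
  The budget subtracts \<open>ln B\<close>, so nodes below \<open>B\<close> never have a nonnegative budget; above \<open>B\<close> the rounding costs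
  at most \<open>b - a\<close> per step.
\<close>

lemma prob_shallow_le_supersolution:
  fixes B b :: real
  assumes G: "supersolution a k G q \<beta> \<kappa>" and ab: "a < b" and b0: "0 < b" and B: "1 < B" "- (b - a) \<le> ln (1 - 1 / B)"
    and N: "1 \<le> N" "real k * (real N + real k) * (C / B) \<le> \<kappa> * \<beta>"
    and n: "0 \<le> ln (real n) - b * real t - ln B"
  shows "prob {\<omega>\<in>space M. sh t n \<omega>} \<le> G (ln (real n) - b * real t - ln B) + (real n + 1) * q ^ N"
proof -
  note G' = G[unfolded supersolution_def]
  define \<phi> where "\<phi> t y = G (ln (real y) - b * real t - ln B)" for t y :: nat
  have lt1: "0 \<le> ln (real y) - b * real t - ln B" if "\<phi> t y < 1" for t y
  proof (rule ccontr)
    assume "\<not> ?thesis"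
    then have "\<phi> t y = 1" using G' unfolding \<phi>_def by (simp add: not_le)
    with that show False by simp
  qed
  have step: "0 < x \<and> (\<forall>p\<in>{1..k}. \<forall>y. prob {\<omega>\<in>space M. Z (x, p) \<omega> = y} \<le> C / real x) \<and>
      (\<Prod>p\<in>{1..k}. \<integral>\<omega>. \<phi> t (Z (x, p) \<omega>) \<partial>M) + real k * (real N + real k) * (C / real x) \<le> \<phi> (Suc t) x"
    if x1: "\<phi> (Suc t) x < 1" for t x
  proof -
    define v where "v = ln (real x) - b * real (Suc t) - ln B"
    have v: "0 \<le> v" unfolding v_def by (rule lt1[OF x1])
    have lnB: "0 < ln B" using B by simp
    have "0 \<le> b * real (Suc t)" using b0 by simp
    then have B_x: "ln B \<le> ln (real x)" using v unfolding v_def by linarith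
    \<comment> \<open>In HOL \<open>ln 0 = 0\<close>, so the root has to be excluded separately;
      \<open>ln B > 0\<close> does this.\<close>
    then have x: "0 < x" using lnB by (cases "x = 0") auto
    from B_x have xB: "B \<le> real x" using x B by simp
    have le: "AE \<omega> in M. \<phi> t (parent x (X \<omega>)) \<le> G (v + (a + L \<omega>))"
      using X_AE
    proof eventually_elim
      case (elim \<omega>)
      have ln_xX: "ln (real x * X \<omega>) = ln (real x) + L \<omega>" using elim x by (simp add: ln_mult)
      have w: "v + (a + L \<omega>) = ln (real x * X \<omega>) - b * real t - ln B - (b - a)"
        unfolding ln_xX v_def by (simp add: algebra_simps)
      show ?case
      \<comment> \<open>If \<open>x * X\<close> is below \<open>B\<close>, the compared budget is
        negative and \<open>G\<close> is 1 there. Otherwise rounding shrinks \<open>x * X\<close> at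
        most by the factor \<open>1 - 1 / B\<close>, whose logarithm is covered by
        \<open>b - a\<close>.\<close>
      proof (cases "real x * X \<omega> < B")
        case True
        then have "ln (real x * X \<omega>) < ln B" using elim x B by (subst ln_less_cancel_iff) auto
        then have "v + (a + L \<omega>) < 0"
          using ab b0 mult_nonneg_nonneg[of b "real t"] unfolding w by linarith
        then have "G (v + (a + L \<omega>)) = 1" using G' by blast
        then show ?thesis unfolding \<phi>_def using supersolution_le_1[OF G] by simp
      next
        case False
        let ?y = "real (parent x (X \<omega>))"
        have "real x * X \<omega> * (1 - 1 / B) \<le> real x * X \<omega> - 1"
          using False B by (simp add: field_simps)
        also have "\<dots> \<le> ?y" using real_parent(2)[of "X \<omega>" x] elim by simp
        finally have y: "real x * X \<omega> * (1 - 1 / B) \<le> ?y" .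
        have pos: "0 < real x * X \<omega>" "0 < 1 - 1 / B" using elim x B by (auto simp: field_simps)
        then have "ln (real x * X \<omega>) + ln (1 - 1 / B) = ln (real x * X \<omega> * (1 - 1 / B))"
          by (rule ln_mult_pos[symmetric])
        also have "\<dots> \<le> ln ?y" using y pos by (intro ln_mono) auto
        finally have "v + (a + L \<omega>) \<le> ln ?y - b * real t - ln B" unfolding w using B(2) by linarith
        then show ?thesis unfolding \<phi>_def by (rule antimonoD[OF conjunct1[OF G']])
      qed
    qed
    have E: "(\<integral>\<omega>. \<phi> t (Z (x, p) \<omega>) \<partial>M) \<le> (\<integral>\<omega>. G (v + (a + L \<omega>)) \<partial>M)" if "p \<in> {1..k}" for p
      unfolding expectation_Z[OF that]
      by (rule integral_mono_AE[OF integrable_parent supersolution_integrable[OF G] le])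
    have "(\<Prod>p\<in>{1..k}. \<integral>\<omega>. \<phi> t (Z (x, p) \<omega>) \<partial>M) \<le> (\<Prod>p\<in>{1..k}. \<integral>\<omega>. G (v + (a + L \<omega>)) \<partial>M)"
      using E supersolution_pos[OF G]
      by (intro prod_mono conjI Bochner_Integration.integral_nonneg) (auto simp: \<phi>_def less_imp_le)
    also have "\<dots> = (\<integral>\<omega>. G (v + (a + L \<omega>)) \<partial>M) ^ k" by simp
    also have "\<dots> \<le> (1 - \<kappa>) * G v" using G' v by blast
    finally have 1: "(\<Prod>p\<in>{1..k}. \<integral>\<omega>. \<phi> t (Z (x, p) \<omega>) \<partial>M) \<le> (1 - \<kappa>) * G v" .
    have "real k * (real N + real k) * (C / real x) \<le> real k * (real N + real k) * (C / B)"
      using xB B C_nonneg by (intro mult_left_mono divide_left_mono) auto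
    also have "\<dots> \<le> \<kappa> * \<beta>" by (rule N(2))
    also have "\<dots> \<le> \<kappa> * G v" using G' by (intro mult_left_mono) auto
    finally have 2: "real k * (real N + real k) * (C / real x) \<le> \<kappa> * G v" .
    have "\<phi> (Suc t) x = G v" by (simp add: \<phi>_def v_def)
    then show ?thesis using x 1 2 prob_Z_eq_le[OF _ x] by (auto simp: algebra_simps)
  qed
  have \<phi>n: "\<phi> t n \<le> q" unfolding \<phi>_def using G' n by blast
  have "prob {\<omega>\<in>space M. \<forall>y\<in>{n}. sh t y \<omega>} \<le> (\<Prod>y\<in>{n}. \<phi> t y) + real (Suc n) * q ^ N"
  proof (rule prob_all_sh_le[where c="\<lambda>x. C / real x"])
    show "\<phi> t y \<le> q" if "\<phi> t y < 1" for t y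
      using lt1[OF that] G' unfolding \<phi>_def by blast
    show "\<phi> t y < 1" if "y \<in> {n}" for y using that \<phi>n G' by auto
  qed (use step G' supersolution_le_1[OF G] supersolution_pos[OF G] N(1) in \<open>auto simp: \<phi>_def less_imp_le\<close>)
  then show ?thesis by (simp add: \<phi>_def algebra_simps)
qed

section \<open>Limits along \<open>z * ln n\<close>\<close>

lemma deep_tendsto_0:
  assumes z: "sarrd_rate M k X < z"
  shows "(\<lambda>n. prob {\<omega>\<in>space M. \<not> sh (Suc (nat \<lfloor>z * ln (real n)\<rfloor>)) n \<omega>}) \<longlonglongrightarrow> 0"
proof -
  obtain s where s: "0 < s" "s + z * ln (real k * (\<integral>\<omega>. exp (s * L \<omega>) \<partial>M)) < 0"
    by (rule above_rate[OF k1 z])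
  define \<rho> where "\<rho> = real k * (\<integral>\<omega>. exp (s * L \<omega>) \<partial>M)"
  have "0 < (\<integral>\<omega>. exp (s * L \<omega>) \<partial>M)" using s by (intro expectation_exp_pos integrable_exp_L) simp
  then have \<rho>: "0 < \<rho>" using k1 by (simp add: \<rho>_def)
  have z0: "0 < z"
    using sarrd_rate_ge[OF k1] mean_pos z by (meson less_le_trans less_trans zero_less_divide_1_iff)
  have "z * ln \<rho> < 0" using s by (simp add: \<rho>_def)
  then have ln\<rho>: "ln \<rho> < 0" using z0 by (simp add: mult_less_0_iff)
  define c where "c = - (s + z * ln \<rho>)"
  have c: "0 < c" using s(2) by (simp add: c_def \<rho>_def)
  have bound: "prob {\<omega>\<in>space M. \<not> sh (Suc (nat \<lfloor>z * ln (real n)\<rfloor>)) n \<omega>} \<le> exp (- ln \<rho> - c * ln (real n))"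
    if n: "1 \<le> n" for n
  proof -
    let ?t = "nat \<lfloor>z * ln (real n)\<rfloor>"
    have "prob {\<omega>\<in>space M. \<not> sh (Suc ?t) n \<omega>} \<le> real n powr s * \<rho> ^ ?t"
      unfolding \<rho>_def using s by (intro prob_deep_le) simp
    also have "\<dots> = exp (s * ln (real n) + real ?t * ln \<rho>)"
      using n \<rho> by (simp add: powr_def exp_add exp_of_nat_mult)
    also have "\<dots> \<le> exp (- ln \<rho> - c * ln (real n))"
    proof -
      \<comment> \<open>As \<open>ln \<rho>\<close> is negative, rounding the level down costs only
        the constant factor \<open>1 / \<rho>\<close>.\<close>
      have "z * ln (real n) - 1 \<le> real ?t" by linarith
      then have "real ?t * ln \<rho> \<le> (z * ln (real n) - 1) * ln \<rho>"
        using ln\<rho> by (intro mult_right_mono_neg) auto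
      then show ?thesis by (simp add: c_def algebra_simps)
    qed
    finally show ?thesis .
  qed
  have "(\<lambda>n. exp (- ln \<rho> - c * ln (real n))) \<longlonglongrightarrow> 0" using c by real_asymp
  then show ?thesis
    by (rule tendsto_sandwich[OF _ _ tendsto_const, rotated -1])
       (auto intro!: always_eventually eventually_sequentiallyI[of 1] bound)
qed

lemma shallow_tendsto_0_below_mean:
  assumes z: "0 < z" "z < 1 / (\<integral>\<omega>. - L \<omega> \<partial>M)"
  shows "(\<lambda>n. prob {\<omega>\<in>space M. sh (nat \<lceil>z * ln (real n)\<rceil>) n \<omega>}) \<longlonglongrightarrow> 0"
proof -
  obtain s where s: "0 < s" "s \<le> 1 / 4" "z * ln (\<integral>\<omega>. exp (- s * L \<omega>) \<partial>M) < s"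
    by (rule below_mean[OF z])
  define m where "m = (\<integral>\<omega>. exp (- s * L \<omega>) \<partial>M)"
  have m: "0 < m" unfolding m_def using s by (intro expectation_exp_pos integrable_exp_L) simp
  \<comment> \<open>Chosen so that the rounding loss \<open>z * s / B\<close> is exactly half of the
    gap \<open>s - z * ln m\<close>.\<close>
  define B where "B = 2 * z * s / (s - z * ln m)"
  have B: "0 < B" using s z by (simp add: B_def m_def)
  define \<rho> where "\<rho> = (1 + 1 / B) powr s * m"
  have B': "0 < 1 + 1 / B" using B by (simp add: add_pos_pos)
  then have powr: "0 < (1 + 1 / B) powr s" by simp
  then have \<rho>: "0 < \<rho>" using m by (simp add: \<rho>_def)
  have "ln \<rho> = s * ln (1 + 1 / B) + ln m"
    unfolding \<rho>_def using B' ln_mult_pos[OF powr m] by (simp add: ln_powr)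
  also have "s * ln (1 + 1 / B) \<le> s * (1 / B)"
    using s B by (intro mult_left_mono ln_add_one_self_le_self) auto
  finally have "z * ln \<rho> \<le> z * (s * (1 / B) + ln m)" using z by simp
  also have "\<dots> = (s - z * ln m) / 2 + z * ln m" using z s by (simp add: B_def m_def field_simps)
  also have "\<dots> < s" using s by (simp add: m_def field_simps)
  finally have "0 < s - z * ln \<rho>" by simp
  then obtain c where c: "c = s - z * ln \<rho>" "0 < c" by simp
  define l where "l = max 0 (ln \<rho>)"
  have bound: "prob {\<omega>\<in>space M. sh (nat \<lceil>z * ln (real n)\<rceil>) n \<omega>} \<le> (B + 1) powr s * exp (l - c * ln (real n))"
    if n: "1 \<le> n" for n
  proof -
    let ?t = "nat \<lceil>z * ln (real n)\<rceil>"
    have "prob {\<omega>\<in>space M. sh ?t n \<omega>} \<le> (B + 1) powr s * (real n + 1) powr (- s) * \<rho> ^ ?t"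
      unfolding \<rho>_def m_def using s B by (intro prob_shallow_le) auto
    also have "\<dots> \<le> (B + 1) powr s * real n powr (- s) * \<rho> ^ ?t"
      using s n \<rho> by (intro mult_right_mono mult_left_mono powr_mono2') auto
    also have "\<dots> = (B + 1) powr s * exp (- s * ln (real n) + real ?t * ln \<rho>)"
    proof -
      have "real n powr (- s) = exp (- s * ln (real n))" using n by (simp add: powr_def)
      moreover have "\<rho> ^ ?t = exp (real ?t * ln \<rho>)" using \<rho> by (simp add: exp_of_nat_mult)
      ultimately show ?thesis by (simp only: mult.assoc exp_add)
    qed
    also have "\<dots> \<le> (B + 1) powr s * exp (l - c * ln (real n))"
    proof -
      have zl: "0 \<le> z * ln (real n)" using z n by simp
      have t: "real ?t \<le> z * ln (real n) + 1" "z * ln (real n) \<le> real ?t" using zl by linarith+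
      have "real ?t * ln \<rho> - z * ln (real n) * ln \<rho> = (real ?t - z * ln (real n)) * ln \<rho>"
        by (simp add: algebra_simps)
      also have "\<dots> \<le> (real ?t - z * ln (real n)) * l"
        using t by (intro mult_left_mono) (auto simp: l_def)
      also have "\<dots> \<le> 1 * l" using t by (intro mult_right_mono) (auto simp: l_def)
      finally show ?thesis by (intro mult_left_mono) (auto simp: c algebra_simps)
    qed
    finally show ?thesis .
  qed
  have "(\<lambda>n. (B + 1) powr s * exp (l - c * ln (real n))) \<longlonglongrightarrow> 0" using c(2) by real_asymp
  then show ?thesis
    by (rule tendsto_sandwich[OF _ _ tendsto_const, rotated -1])
       (auto intro!: always_eventually eventually_sequentiallyI[of 1] bound)
qed

lemma shallow_tendsto_0_above_mean:
  assumes z: "1 / (\<integral>\<omega>. - L \<omega> \<partial>M) \<le> z" "z < sarrd_rate M k X"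
  shows "(\<lambda>n. prob {\<omega>\<in>space M. sh (nat \<lceil>z * ln (real n)\<rceil>) n \<omega>}) \<longlonglongrightarrow> 0"
proof (rule order_tendstoI)
  fix e :: real assume e: "0 < e"
  have z0: "0 < z" using z(1) mean_pos by (meson less_le_trans zero_less_divide_1_iff)
  obtain z' where z': "z < z'" "0 < z'"
    "\<And>s. 0 \<le> s \<Longrightarrow> exp (- s * (1 / z')) \<le> real k * (\<integral>\<omega>. exp (s * L \<omega>) \<partial>M)"
    by (rule below_rate[OF k1 z(2)]) (rule that)
  \<comment> \<open>Two intermediate slopes provide three strict gaps: \<open>1 / z' < a\<close> for
    growth, \<open>a < b\<close> for the rounding, and \<open>b < 1 / z\<close> so that the starting
    budget grows with \<open>ln n\<close>.\<close>
  define z2 where "z2 = (2 * z + z') / 3"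
  define z1 where "z1 = (z + 2 * z') / 3"
  have zz: "z < z2" "z2 < z1" "z1 < z'" using z'(1) by (auto simp: z1_def z2_def)
  define a b where "a = 1 / z1" and "b = 1 / z2"
  have ab: "1 / z' < a" "a < b" "b < 1 / z" "0 < b"
    using zz z0 by (auto simp: a_def b_def intro: divide_strict_left_mono)
  have "1 / z \<le> (\<integral>\<omega>. - L \<omega> \<partial>M)" using z(1) z0 mean_pos by (simp add: field_simps)
  then have neg: "a + (\<integral>\<omega>. L \<omega> \<partial>M) < 0" using ab by simp
  obtain G q \<beta> \<kappa> V where G: "supersolution a k G q \<beta> \<kappa>" and V: "G V \<le> e / 2"
    using supersolution_of_rate[OF neg ab(1) _ z'(3), of "e / 2"] e by auto
  have G': "antimono G" "0 < q" "q < 1" "0 < \<beta>" "0 < \<kappa>" using G by (auto simp: supersolution_def)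
  \<comment> \<open>Before rounding, the starting budget is \<open>2 * \<delta> * ln n\<close>: one
    half is given away as \<open>ln B\<close>, the other still passes \<open>V\<close>.\<close>
  define \<delta> where "\<delta> = (1 - z * b) / 2"
  have \<delta>: "0 < \<delta>" using zz z0 by (simp add: \<delta>_def b_def)
  \<comment> \<open>This makes \<open>q ^ N\<close> at most \<open>1 / n ^ 2\<close>, enough against
    the factor \<open>n + 1\<close>, while \<open>N\<close> stays logarithmic and is beaten by
    \<open>B = n powr \<delta>\<close>.\<close>
  define d where "d = 2 / - ln q"
  have lnq: "ln q < 0" using G' by simp
  have d: "0 < d" "d * ln q = - 2" using lnq by (auto simp: d_def divide_pos_neg)
  define N where "N n = nat \<lceil>d * ln (real n)\<rceil> + 1" for n :: nat
  have N_le: "real (N n) \<le> d * ln (real n) + 2" if "1 \<le> n" for n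
  proof -
    have "0 \<le> d * ln (real n)" using d that by simp
    then show ?thesis unfolding N_def by linarith
  qed
  have qN: "q ^ N n \<le> exp (- 2 * ln (real n))" for n
  proof -
    have "d * ln (real n) \<le> real (N n)" unfolding N_def by linarith
    then have "real (N n) * ln q \<le> d * ln (real n) * ln q" using lnq by (intro mult_right_mono_neg) auto
    also have "d * ln (real n) * ln q = (d * ln q) * ln (real n)" by (simp only: mult_ac)
    also have "\<dots> = - 2 * ln (real n)" by (simp only: d(2))
    finally have "exp (real (N n) * ln q) \<le> exp (- 2 * ln (real n))" by simp
    then show ?thesis using G' by (simp add: exp_of_nat_mult)
  qed
  have ev1: "eventually (\<lambda>n. 1 < exp (\<delta> * ln (real n))) sequentially" using \<delta> by real_asymp
  have ev2: "eventually (\<lambda>n. - (b - a) \<le> ln (1 - 1 / exp (\<delta> * ln (real n)))) sequentially"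
  proof -
    have "(\<lambda>n. ln (1 - 1 / exp (\<delta> * ln (real n)))) \<longlonglongrightarrow> 0" using \<delta> by real_asymp
    from order_tendstoD(1)[OF this, of "- (b - a)"] ab show ?thesis by (auto elim: eventually_mono)
  qed
  have ev3: "eventually (\<lambda>n. real k * (d * ln (real n) + 2 + real k) * (C / exp (\<delta> * ln (real n))) \<le> \<kappa> * \<beta>) sequentially"
  proof -
    have "(\<lambda>n. real k * (d * ln (real n) + 2 + real k) * (C / exp (\<delta> * ln (real n)))) \<longlonglongrightarrow> 0"
      using \<delta> by real_asymp
    from order_tendstoD(2)[OF this, of "\<kappa> * \<beta>"] G' show ?thesis by (auto elim: eventually_mono)
  qed
  have ev4: "eventually (\<lambda>n. max V 0 \<le> \<delta> * ln (real n) - b) sequentially" using \<delta> by real_asymp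
  have ev5: "eventually (\<lambda>n. (real n + 1) * exp (- 2 * ln (real n)) < e / 2) sequentially"
  proof -
    have "(\<lambda>n. (real n + 1) * exp (- 2 * ln (real n))) \<longlonglongrightarrow> 0" by real_asymp
    from order_tendstoD(2)[OF this, of "e / 2"] e show ?thesis by simp
  qed
  show "eventually (\<lambda>n. prob {\<omega>\<in>space M. sh (nat \<lceil>z * ln (real n)\<rceil>) n \<omega>} < e) sequentially"
    using ev1 ev2 ev3 ev4 ev5 eventually_ge_at_top[of 1]
  proof eventually_elim
    case (elim n)
    define t where "t = nat \<lceil>z * ln (real n)\<rceil>"
    define B where "B = exp (\<delta> * ln (real n))"
    define v where "v = ln (real n) - b * real t - ln B"
    have "0 \<le> z * ln (real n)" using z0 elim by simp
    then have "real t \<le> z * ln (real n) + 1" unfolding t_def by linarith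
    then have "b * real t \<le> b * (z * ln (real n) + 1)" using ab by (intro mult_left_mono) auto
    then have "\<delta> * ln (real n) - b \<le> v" by (simp add: v_def B_def \<delta>_def field_simps)
    then have v: "V \<le> v" "0 \<le> v" using elim by auto
    have "real k * (real (N n) + real k) * (C / B) \<le> real k * (d * ln (real n) + 2 + real k) * (C / B)"
      using N_le[of n] elim C_nonneg by (intro mult_right_mono mult_left_mono) (auto simp: B_def)
    also have "\<dots> \<le> \<kappa> * \<beta>" using elim by (simp add: B_def)
    finally have "prob {\<omega>\<in>space M. sh t n \<omega>} \<le> G v + (real n + 1) * q ^ N n"
      unfolding v_def using elim v ab
      by (intro prob_shallow_le_supersolution[OF G]) (auto simp: B_def v_def N_def)
    also have "G v \<le> e / 2" using antimonoD[OF G'(1) v(1)] V by simp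
    also have "(real n + 1) * q ^ N n \<le> (real n + 1) * exp (- 2 * ln (real n))"
      using qN by (intro mult_left_mono) auto
    finally show "prob {\<omega>\<in>space M. sh (nat \<lceil>z * ln (real n)\<rceil>) n \<omega>} < e"
      using elim by (simp add: t_def)
  qed
qed (auto intro!: always_eventually intro: less_le_trans)

lemma shallow_tendsto_0:
  assumes z: "0 < z" "z < sarrd_rate M k X"
  shows "(\<lambda>n. prob {\<omega>\<in>space M. sh (nat \<lceil>z * ln (real n)\<rceil>) n \<omega>}) \<longlonglongrightarrow> 0"
  using shallow_tendsto_0_below_mean[OF z(1)] shallow_tendsto_0_above_mean[OF _ z(2)] by fastforce

lemma depth_tendsto_in_probability:
  "tendsto_in_probability M
     (\<lambda>n \<omega>. real (sarrd_depth k (\<lambda>x p. U x p \<omega>) n) / ln (real n)) (sarrd_rate M k X)"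
  unfolding tendsto_in_probability_def
proof (intro conjI allI impI)
  let ?D = "\<lambda>n \<omega>. sarrd_depth k (\<lambda>x p. U x p \<omega>) n" and ?r = "sarrd_rate M k X"
  have D [measurable]: "?D n \<in> measurable M (count_space UNIV)" for n
    by (rule measurable_sarrd_depth) (rule U_measurable)
  show "(\<lambda>\<omega>. real (?D n \<omega>) / ln (real n)) \<in> borel_measurable M" for n by measurable
  fix \<epsilon> :: real assume \<epsilon>: "0 < \<epsilon>"
  have r: "0 < ?r" using sarrd_rate_ge[OF k1] mean_pos by (meson less_le_trans zero_less_divide_1_iff)
  \<comment> \<open>The maximum with half of the rate keeps \<open>z\<close> positive when
    \<open>\<epsilon>\<close> exceeds the rate.\<close>
  define z where "z = max (?r - \<epsilon>) (?r / 2)"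
  have z: "0 < z" "z < ?r" "?r - \<epsilon> \<le> z" using r \<epsilon> by (auto simp: z_def)
  let ?P = "\<lambda>n. prob {\<omega>\<in>space M. \<not> sh (Suc (nat \<lfloor>(?r + \<epsilon>) * ln (real n)\<rfloor>)) n \<omega>}"
  let ?Q = "\<lambda>n. prob {\<omega>\<in>space M. sh (nat \<lceil>z * ln (real n)\<rceil>) n \<omega>}"
  have bound: "prob {\<omega>\<in>space M. \<epsilon> < \<bar>real (?D n \<omega>) / ln (real n) - ?r\<bar>} \<le> ?P n + ?Q n" if n: "2 \<le> n" for n
  proof -
    let ?t1 = "Suc (nat \<lfloor>(?r + \<epsilon>) * ln (real n)\<rfloor>)" and ?t2 = "nat \<lceil>z * ln (real n)\<rceil>"
    let ?A1 = "{\<omega>\<in>space M. \<not> sh ?t1 n \<omega>}" and ?A2 = "{\<omega>\<in>space M. sh ?t2 n \<omega>}"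
    have ln: "0 < ln (real n)" using n by simp
    have "prob {\<omega>\<in>space M. \<epsilon> < \<bar>real (?D n \<omega>) / ln (real n) - ?r\<bar>} \<le> prob (?A1 \<union> ?A2)"
    proof (rule finite_measure_mono_AE)
      show "AE \<omega> in M. \<omega> \<in> {\<omega>\<in>space M. \<epsilon> < \<bar>real (?D n \<omega>) / ln (real n) - ?r\<bar>} \<longrightarrow> \<omega> \<in> ?A1 \<union> ?A2"
        using depth_less_AE
      proof eventually_elim
        case (elim \<omega>)
        have "?t1 \<le> ?D n \<omega> \<or> ?D n \<omega> < ?t2" if gap: "\<epsilon> < \<bar>real (?D n \<omega>) / ln (real n) - ?r\<bar>"
        proof -
          consider "?r + \<epsilon> < real (?D n \<omega>) / ln (real n)" | "real (?D n \<omega>) / ln (real n) < ?r - \<epsilon>"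
            using gap by linarith
          then show ?thesis
          proof cases
            case 1
            then have "(?r + \<epsilon>) * ln (real n) < real (?D n \<omega>)" using ln by (simp add: pos_less_divide_eq)
            moreover have "0 \<le> (?r + \<epsilon>) * ln (real n)" using ln r \<epsilon> by simp
            ultimately have "nat \<lfloor>(?r + \<epsilon>) * ln (real n)\<rfloor> < ?D n \<omega>" by linarith
            then show ?thesis by simp
          next
            case 2
            then have "real (?D n \<omega>) < (?r - \<epsilon>) * ln (real n)" using ln by (simp add: pos_divide_less_eq)
            also have "\<dots> \<le> z * ln (real n)" using z ln by (intro mult_right_mono) auto
            finally have "?D n \<omega> < ?t2" by linarith
            then show ?thesis ..
          qed
        qed
        then show ?case using elim by (auto simp: not_less[symmetric])
      qed
    qed measurable
    also have "\<dots> \<le> ?P n + ?Q n" by (rule measure_Un_le) measurable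
    finally show ?thesis .
  qed
  have "(\<lambda>n. ?P n + ?Q n) \<longlonglongrightarrow> 0 + 0"
    by (intro tendsto_add deep_tendsto_0 shallow_tendsto_0 z) (use \<epsilon> in simp)
  then have "(\<lambda>n. ?P n + ?Q n) \<longlonglongrightarrow> 0" by simp
  then show "(\<lambda>n. prob {\<omega>\<in>space M. \<epsilon> < \<bar>real (?D n \<omega>) / ln (real n) - ?r\<bar>}) \<longlonglongrightarrow> 0"
    by (rule tendsto_sandwich[OF _ _ tendsto_const, rotated -1])
       (auto intro!: always_eventually eventually_sequentiallyI[of 2] bound)
qed

end

theorem theorem4p1:
  fixes M :: "'a measure" and k :: nat and X :: "'a \<Rightarrow> real"
    and f :: "real \<Rightarrow> ennreal" and C :: real
    and U :: "nat \<Rightarrow> nat \<Rightarrow> 'a \<Rightarrow> real"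
  assumes "prob_space M"
    and "k \<ge> 1"
    and "AE \<omega> in M. X \<omega> \<in> {0<..<1}"
    and "distributed M lborel X f"
    and "\<And>x. f x \<le> ennreal C"
    and "sarrd_attachment M k X U"
  shows "tendsto_in_probability M
           (\<lambda>n \<omega>. real (sarrd_depth k (\<lambda>x p. U x p \<omega>) n) / ln (real n))
           (sarrd_rate M k X)"
proof -
  interpret prob_space M by fact
  interpret sarrd M X f C k U by unfold_locales (use assms in auto)
  show ?thesis by (rule depth_tendsto_in_probability)
qed

end
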